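(* Let $0<q<1$ and $v>-1$ with $q\in Q_v$, and let $a,b>0$. Then for all $c,d\in\mathbb{R}_q^+$ satisfying $$0<B_{q,v}^2\,\frac{\sigma_a\sigma_b}{(cd)^{2v+2}}<1,$$ and for every function $f\in\mathcal{L}_{q,2,v}$, one has $$c^{a}\,\big\|x^{a/2}f\big\|_{q,2,v}^{2}+d^{b}\,\big\|x^{b/2}\mathcal{F}_{q,v}f\big\|_{q,2,v}^{2}\ \geq\ -\log\left(B_{q,v}^2\,\frac{\sigma_a\sigma_b}{(cd)^{2v+2}}\right)\|f\|_{q,2,v}^{2}.$$
   Context: Throughout $0<q<1$ and $v>-1$. Notation: $(a;p)_n=\prod_{k=0}^{n-1}(1-ap^k)$ and $(a;p)_\infty=\prod_{k\ge 0}(1-ap^k)$. $\mathbb{R}_q=\{\pm q^n: n\in\mathbb{Z}\}$, $\mathbb{R}_q^+=\{q^n:n\in\mathbb{Z}\}$. The $q$-Jackson integral of a function $f$ on $\mathbb{R}_q$ is $\int_0^\infty f(t)\,d_qt=(1-q)\sum_{n\in\mathbb{Z}}q^nf(q^n)$. For $p\geq 1$, $\mathcal{L}_{q,p,v}$ is the space of even (complex-valued) functions $f$ on $\mathbb{R}_q$ with $\|f\|_{q,p,v}=\left[\int_0^\infty |f(x)|^px^{2v+1}d_qx\right]^{1/p}<\infty$. Expressions such as $\|x^{a/2}f\|_{q,2,v}^2$ stand for $\int_0^\infty x^{a}|f(x)|^2x^{2v+1}d_qx\in[0,\infty]$. The normalized Hahn-Exton $q$-Bessel function is $j_v(x,q^2)=\sum_{n=0}^\infty(-1)^n\frac{q^{n(n+1)}}{(q^{2v+2};q^2)_n(q^2;q^2)_n}x^{2n}$.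 The $q$-Bessel Fourier transform is $$\mathcal{F}_{q,v}f(x)=c_{q,v}\int_0^\infty f(t)j_v(xt,q^2)t^{2v+1}d_qt,\quad x\in\mathbb{R}_q,\qquad c_{q,v}=\frac{1}{1-q}\frac{(q^{2v+2};q^2)_\infty}{(q^2;q^2)_\infty}.$$ The $q$-translation operator is $T_{q,x}^vf(y)=c_{q,v}\int_0^\infty\mathcal{F}_{q,v}f(t)\,j_v(yt,q^2)j_v(xt,q^2)t^{2v+1}d_qt$ for $f\in\mathcal{L}_{q,1,v}$. It is called positive if $f\geq0$ implies $T^v_{q,x}f\geq 0$ for all $x\in\mathbb{R}_q$. $Q_v$ is the set of $q\in(0,1)$ for which $T^v_{q,x}$ is positive. Constants: $B_{q,v}=\frac{1}{1-q}\frac{(-q^2;q^2)_\infty(-q^{2v+2};q^2)_\infty}{(q^2;q^2)_\infty}$, and for $a>0$, $\sigma_a=\int_0^\infty\exp(-|x|^a)x^{2v+1}d_qx$. *)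

theory Defs
  imports "HOL-Analysis.Analysis"
begin

definition qpoch :: "real \<Rightarrow> real \<Rightarrow> nat \<Rightarrow> real" where
  "qpoch a p n = (\<Prod>k<n. 1 - a * p ^ k)"

definition qpoch_inf :: "real \<Rightarrow> real \<Rightarrow> real" where
  "qpoch_inf a p = (\<Prod>k. 1 - a * p ^ k)"

definition Rq_pos :: "real \<Rightarrow> real set" where
  "Rq_pos q = {q powi n | n :: int. True}"

definition Rq :: "real \<Rightarrow> real set" where
  "Rq q = Rq_pos q \<union> uminus ` Rq_pos q"

text \<open>
  Functions on \<open>Rq q\<close> are represented by functions on all reals; nothing below evaluates them
  outside \<open>Rq q\<close>. The Jackson integral comes in two versions: one for (absolutely convergent)
  real or complex integrands, and one for integrands with values in \<open>[0,\<infinity>]\<close>, which always exists.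
\<close>

definition jackson_integral :: "real \<Rightarrow> (real \<Rightarrow> 'a :: real_normed_vector) \<Rightarrow> 'a" where
  "jackson_integral q f = (1 - q) *\<^sub>R (\<Sum>\<^sub>\<infinity>n::int. (q powi n) *\<^sub>R f (q powi n))"

definition jackson_nn_integral :: "real \<Rightarrow> (real \<Rightarrow> ennreal) \<Rightarrow> ennreal" where
  "jackson_nn_integral q f = ennreal (1 - q) * (\<Sum>\<^sub>\<infinity>n::int. ennreal (q powi n) * f (q powi n))"

text \<open>The norm takes the value \<open>\<infinity>\<close> on functions outside the corresponding space.\<close>

definition Lq_norm :: "real \<Rightarrow> real \<Rightarrow> real \<Rightarrow> (real \<Rightarrow> complex) \<Rightarrow> ennreal" where
  "Lq_norm q p v f =
     (let I = jackson_nn_integral q (\<lambda>x. ennreal (cmod (f x) powr p * x powr (2 * v + 1)))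
      in if I = \<infinity> then \<infinity> else ennreal (enn2real I powr (1 / p)))"

definition Lq :: "real \<Rightarrow> real \<Rightarrow> real \<Rightarrow> (real \<Rightarrow> complex) set" where
  "Lq q p v = {f. (\<forall>x\<in>Rq q. f (- x) = f x) \<and> Lq_norm q p v f < \<infinity>}"

text \<open>The normalized Hahn--Exton function \<open>j\<^sub>v(x, q\<^sup>2)\<close>; the parameter here is \<open>q\<close>, not \<open>q\<^sup>2\<close>.\<close>

definition qbessel_j :: "real \<Rightarrow> real \<Rightarrow> real \<Rightarrow> real" where
  "qbessel_j q v x =
     (\<Sum>n. (-1) ^ n * (q ^ (n * (n + 1)) / (qpoch (q powr (2 * v + 2)) (q\<^sup>2) n * qpoch (q\<^sup>2) (q\<^sup>2) n))
           * x ^ (2 * n))"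

definition c_const :: "real \<Rightarrow> real \<Rightarrow> real" where
  "c_const q v = 1 / (1 - q) * (qpoch_inf (q powr (2 * v + 2)) (q\<^sup>2) / qpoch_inf (q\<^sup>2) (q\<^sup>2))"

definition qbessel_fourier :: "real \<Rightarrow> real \<Rightarrow> (real \<Rightarrow> complex) \<Rightarrow> real \<Rightarrow> complex" where
  "qbessel_fourier q v f x =
     of_real (c_const q v) *
     jackson_integral q (\<lambda>t. f t * of_real (qbessel_j q v (x * t)) * of_real (t powr (2 * v + 1)))"

definition q_translation :: "real \<Rightarrow> real \<Rightarrow> real \<Rightarrow> (real \<Rightarrow> complex) \<Rightarrow> real \<Rightarrow> complex" where
  "q_translation q v x f y =
     of_real (c_const q v) *
     jackson_integral q (\<lambda>t. qbessel_fourier q v f t * of_real (qbessel_j q v (y * t)) *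
       of_real (qbessel_j q v (x * t)) * of_real (t powr (2 * v + 1)))"

definition q_translation_positive :: "real \<Rightarrow> real \<Rightarrow> bool" where
  "q_translation_positive q v \<longleftrightarrow>
     (\<forall>f\<in>Lq q 1 v. (\<forall>y\<in>Rq q. f y \<in> \<real>\<^sub>\<ge>\<^sub>0) \<longrightarrow>
        (\<forall>x\<in>Rq q. \<forall>y\<in>Rq q. q_translation q v x f y \<in> \<real>\<^sub>\<ge>\<^sub>0))"

definition Q_set :: "real \<Rightarrow> real set" where
  "Q_set v = {q. 0 < q \<and> q < 1 \<and> q_translation_positive q v}"

definition B_const :: "real \<Rightarrow> real \<Rightarrow> real" where
  "B_const q v =
     1 / (1 - q) * (qpoch_inf (- (q\<^sup>2)) (q\<^sup>2) * qpoch_inf (- (q powr (2 * v + 2))) (q\<^sup>2) / qpoch_inf (q\<^sup>2) (q\<^sup>2))"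

definition sigma_const :: "real \<Rightarrow> real \<Rightarrow> real \<Rightarrow> real" where
  "sigma_const q v a = jackson_integral q (\<lambda>x. exp (- (\<bar>x\<bar> powr a)) * x powr (2 * v + 1))"

end

theory Submission
  imports Defs
begin

text \<open>
  Substituting \<open>\<phi> n = q\<^bsup>(v+1)n\<^esup> f(q\<^sup>n)\<close> turns the \<open>q\<close>-Bessel transform into the operator
  \<open>(U \<phi>) n = (\<Sum>m. u (n + m) \<phi> m)\<close> on \<open>\<ell>\<^sup>2(\<int>)\<close>. Euler's expansion shows that \<open>u\<close> is the correlation of the
  coefficients of \<open>(s x; q\<^sup>2)\<^sub>\<infinity>\<close> and of its reciprocal, \<open>s = q\<^bsup>v+1\<^esup>\<close>; hence the translates of \<open>u\<close>
  are orthonormal, \<open>U\<close> is an isometry, and \<open>\<bar>u n\<bar> \<le> (1 - q) B s\<^sup>n\<close>.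

  Let \<open>\<alpha>\<close> and \<open>\<beta>\<close> be half the multiplication operators weighting \<open>U \<phi>\<close> and \<open>\<phi>\<close>. The bound on
  \<open>u\<close> makes the Hilbert--Schmidt norm of \<open>exp (-\<alpha>) U exp (-\<beta>)\<close> at most \<open>M\<close>, where \<open>M\<^sup>2\<close> is the
  argument of the logarithm in the claim. Halving the exponents takes the square root of the operator
  norm bound (Heinz), so \<open>\<parallel>exp (-\<theta> \<alpha>) U exp (-\<theta> \<beta>)\<parallel> \<le> M\<^sup>\<theta>\<close> for \<open>\<theta> = 1 / 2\<^sup>k\<close>, and the
  derivative at \<open>\<theta> = 0\<close> is the uncertainty inequality.
\<close>

section \<open>Unordered sums\<close>

lemma summable_on_bound:
  fixes f g :: "'a \<Rightarrow> real"
  assumes "g summable_on A" "\<And>x. x \<in> A \<Longrightarrow> \<bar>f x\<bar> \<le> g x"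
  shows "f summable_on A"
  by (rule Infinite_Sum.abs_summable_summable, rule Infinite_Sum.abs_summable_on_comparison_test')
     (use assms in auto)

lemma summable_on_abs:
  fixes f :: "'a \<Rightarrow> real"
  assumes "f summable_on A"
  shows "(\<lambda>x. \<bar>f x\<bar>) summable_on A"
  using assms summable_on_iff_abs_summable_on_real by auto

lemma summable_on_times:
  fixes f :: "'a \<Rightarrow> real" and g :: "'b \<Rightarrow> real"
  assumes "f summable_on A" "g summable_on B"
  shows "(\<lambda>(x, y). f x * g y) summable_on A \<times> B"
proof (rule summable_on_bound)
  show "(\<lambda>(x, y). \<bar>f x\<bar> * \<bar>g y\<bar>) summable_on A \<times> B"
    using summable_on_abs[OF assms(1)] summable_on_abs[OF assms(2)]
    by (intro summable_on_SigmaI[where g = "\<lambda>x. \<bar>f x\<bar> * infsum (\<lambda>y. \<bar>g y\<bar>) B"])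
       (auto intro!: has_sum_cmult_right summable_on_cmult_left)
qed (auto simp: abs_mult)

lemma infsum_shift:
  fixes f :: "int \<Rightarrow> 'a :: {comm_monoid_add, t2_space}"
  shows "(\<Sum>\<^sub>\<infinity>n. f (n + k)) = infsum f UNIV"
    and "(\<Sum>\<^sub>\<infinity>n. f (k - n)) = infsum f UNIV"
proof -
  show "(\<Sum>\<^sub>\<infinity>n. f (n + k)) = infsum f UNIV"
    by (rule infsum_reindex_bij_witness[of _ "\<lambda>n. n - k" "\<lambda>n. n + k"]) auto
  show "(\<Sum>\<^sub>\<infinity>n. f (k - n)) = infsum f UNIV"
    by (rule infsum_reindex_bij_witness[of _ "\<lambda>n. k - n" "\<lambda>n. k - n"]) auto
qed

lemma summable_on_shift:
  fixes f :: "int \<Rightarrow> 'a :: {comm_monoid_add, t2_space}"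
  shows "(\<lambda>n. f (k + n)) summable_on UNIV \<longleftrightarrow> f summable_on UNIV"
    and "(\<lambda>n. f (k - n)) summable_on UNIV \<longleftrightarrow> f summable_on UNIV"
proof -
  show "(\<lambda>n. f (k + n)) summable_on UNIV \<longleftrightarrow> f summable_on UNIV"
    by (rule summable_on_reindex_bij_witness[of _ "\<lambda>n. n - k" "\<lambda>n. k + n"]) auto
  show "(\<lambda>n. f (k - n)) summable_on UNIV \<longleftrightarrow> f summable_on UNIV"
    by (rule summable_on_reindex_bij_witness[of _ "\<lambda>n. k - n" "\<lambda>n. k - n"]) auto
qed

lemma summable_on_bounded:
  fixes f :: "'a \<Rightarrow> real"
  assumes "f summable_on UNIV"
  obtains K where "\<And>x. \<bar>f x\<bar> \<le> K"
proof
  have s: "(\<lambda>x. \<bar>f x\<bar>) summable_on UNIV"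
    using assms by (rule summable_on_abs)
  show "\<bar>f x\<bar> \<le> (\<Sum>\<^sub>\<infinity>x. \<bar>f x\<bar>)" for x
    using finite_sum_le_infsum[OF s, of "{x}"] by simp
qed

lemma summable_on_mult_bounded:
  fixes f g :: "'a \<Rightarrow> real"
  assumes "f summable_on A" and "\<And>x. x \<in> A \<Longrightarrow> \<bar>g x\<bar> \<le> K"
  shows "(\<lambda>x. f x * g x) summable_on A"
proof (rule summable_on_bound)
  show "(\<lambda>x. \<bar>f x\<bar> * K) summable_on A"
    using assms by (intro summable_on_cmult_left summable_on_abs)
  show "\<bar>f x * g x\<bar> \<le> \<bar>f x\<bar> * K" if "x \<in> A" for x
    using assms(2)[OF that] by (simp add: abs_mult mult_left_mono)
qed

text \<open>The bijection \<open>(n, l) \<mapsto> (l, n + l)\<close> of the integer plane turns the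
  family into a product.\<close>

lemma summable_on_correlation:
  fixes a b :: "int \<Rightarrow> real"
  assumes "a summable_on UNIV" "b summable_on UNIV"
  shows "(\<lambda>(n, l). a l * b (n + l)) summable_on UNIV \<times> UNIV"
proof -
  have "(\<lambda>(n, l). a l * b (n + l)) summable_on UNIV \<times> UNIV \<longleftrightarrow>
      (\<lambda>(l, m). a l * b m) summable_on UNIV \<times> UNIV"
    by (rule summable_on_reindex_bij_witness[of _ "\<lambda>(l, m). (m - l, l)" "\<lambda>(n, l). (l, n + l)"]) auto
  then show ?thesis
    using summable_on_times[OF assms] by simp
qed

text \<open>Power series coefficients are extended by zero to all integers, so that reflections and
  correlations have no boundary terms; this returns to sums over the naturals.\<close>

lemma has_sum_int_nat:
  fixes f :: "int \<Rightarrow> 'a :: {comm_monoid_add, topological_space}"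
  assumes "\<And>l. l < 0 \<Longrightarrow> f l = 0"
  shows "(f has_sum S) UNIV \<longleftrightarrow> ((\<lambda>n. f (int n)) has_sum S) UNIV"
proof -
  have "(f has_sum S) UNIV \<longleftrightarrow> (f has_sum S) (range int)"
    by (rule has_sum_cong_neutral) (use assms in \<open>auto simp: image_iff, metis nonneg_int_cases not_less\<close>)
  also have "\<dots> \<longleftrightarrow> ((\<lambda>n. f (int n)) has_sum S) UNIV"
    by (subst has_sum_reindex) (auto simp: o_def)
  finally show ?thesis .
qed

lemma has_sum_times:
  fixes f :: "'a \<Rightarrow> real" and g :: "'b \<Rightarrow> real"
  assumes "(f has_sum a) A" "(g has_sum b) B"
  shows "((\<lambda>(x, y). f x * g y) has_sum (a * b)) (A \<times> B)"
proof (rule has_sum_SigmaI)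
  show "((\<lambda>y. case (x, y) of (x, y) \<Rightarrow> f x * g y) has_sum (f x * b)) B" for x
    using assms by (auto intro: has_sum_cmult_right)
  show "((\<lambda>x. f x * b) has_sum (a * b)) A"
    using assms by (intro has_sum_cmult_left)
  show "(\<lambda>(x, y). f x * g y) summable_on A \<times> B"
    using assms by (intro summable_on_times) (auto intro: has_sum_imp_summable)
qed

lemma abs_mult_le_sum_squares: "\<bar>x * y\<bar> \<le> x\<^sup>2 + y\<^sup>2" for x y :: real
proof -
  have "2 * (\<bar>x\<bar> * \<bar>y\<bar>) \<le> x\<^sup>2 + y\<^sup>2"
    using sum_squares_bound[of "\<bar>x\<bar>" "\<bar>y\<bar>"] by simp
  moreover have "0 \<le> \<bar>x\<bar> * \<bar>y\<bar>" by simp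
  ultimately show ?thesis unfolding abs_mult by linarith
qed

lemma summable_on_times_squares:
  fixes f g :: "'a \<Rightarrow> real"
  assumes "(\<lambda>x. (f x)\<^sup>2) summable_on A" "(\<lambda>x. (g x)\<^sup>2) summable_on A"
  shows "(\<lambda>x. f x * g x) summable_on A"
  by (rule summable_on_bound[OF summable_on_add[OF assms]]) (rule abs_mult_le_sum_squares)

lemma has_sum_diff:
  fixes f g :: "'a \<Rightarrow> real"
  assumes "(f has_sum a) A" "(g has_sum b) A"
  shows "((\<lambda>x. f x - g x) has_sum (a - b)) A"
  using has_sum_add[OF assms(1) has_sum_uminusI[OF assms(2)]] by simp

section \<open>Sums with values in [0, \<infinity>]\<close>

text \<open>The norms live in \<open>ennreal\<close>. A finite total bounds every finite partial
  sum, so the real series converges, and to the same value.\<close>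

lemma infsum_ennreal_finite:
  fixes g :: "'a \<Rightarrow> real"
  assumes g: "\<And>n. 0 \<le> g n" and fin: "(\<Sum>\<^sub>\<infinity>n. ennreal (g n)) \<noteq> \<infinity>"
  shows "g summable_on UNIV" "(\<Sum>\<^sub>\<infinity>n. ennreal (g n)) = ennreal (\<Sum>\<^sub>\<infinity>n. g n)"
proof -
  have SUP: "(\<Sum>\<^sub>\<infinity>n. ennreal (g n)) = (SUP F\<in>{F. finite F \<and> F \<subseteq> UNIV}. ennreal (sum g F))"
    using g by (subst nonneg_infsum_complete) simp_all
  have "ennreal (sum g F) \<le> (\<Sum>\<^sub>\<infinity>n. ennreal (g n))" if "finite F" for F
    unfolding SUP using that by (intro SUP_upper) auto
  then have "sum g F \<le> enn2real (\<Sum>\<^sub>\<infinity>n. ennreal (g n))" if "finite F" for F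
    using that fin g by (metis enn2real_ennreal enn2real_mono infinity_ennreal_def sum_nonneg top.not_eq_extremum)
  then show sm: "g summable_on UNIV"
    by (intro nonneg_bdd_above_summable_on) (use g in \<open>auto intro!: bdd_aboveI2\<close>)
  show "(\<Sum>\<^sub>\<infinity>n. ennreal (g n)) = ennreal (\<Sum>\<^sub>\<infinity>n. g n)"
    unfolding SUP using infsum_nonneg_is_SUPREMUM_ennreal[OF sm] g by simp
qed

lemma infsum_cmult_right_ennreal:
  fixes f :: "'a \<Rightarrow> ennreal"
  shows "(\<Sum>\<^sub>\<infinity>n. c * f n) = c * (\<Sum>\<^sub>\<infinity>n. f n)"
proof -
  have "{F :: 'a set. finite F \<and> F \<subseteq> UNIV} \<noteq> {}" by auto
  then show ?thesis
    by (simp add: nonneg_infsum_complete SUP_mult_left_ennreal flip: sum_distrib_left)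
qed

section \<open>Euler's expansion of the infinite \<open>q\<close>-Pochhammer symbol\<close>

lemma qpoch_0 [simp]: "qpoch a p 0 = 1"
  by (simp add: qpoch_def)

lemma qpoch_Suc: "qpoch a p (Suc n) = qpoch a p n * (1 - a * p ^ n)"
  by (simp add: qpoch_def)

lemma qpoch_add: "qpoch a p (m + n) = qpoch a p m * qpoch (a * p ^ m) p n"
  by (induction n) (simp_all add: qpoch_Suc power_add mult_ac)

lemma qpoch_pos:
  fixes a p :: real
  assumes "0 \<le> p" "p \<le> 1" "a < 1"
  shows "0 < qpoch a p n"
proof -
  have "a * p ^ k < 1" for k
  proof (cases "a \<le> 0")
    case True
    then have "a * p ^ k \<le> 0" using assms by (simp add: mult_nonpos_nonneg)
    then show ?thesis by linarith
  next
    case False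
    then have "a * p ^ k \<le> a * 1" using assms by (intro mult_left_mono power_le_one) auto
    then show ?thesis using assms by linarith
  qed
  then show ?thesis by (simp add: qpoch_def prod_pos)
qed

lemma qpoch_le_1:
  fixes a p :: real
  assumes "0 \<le> p" "p \<le> 1" "0 \<le> a" "a \<le> 1"
  shows "qpoch a p n \<le> 1"
  unfolding qpoch_def using assms by (intro prod_le_1) (auto intro!: mult_le_one power_le_one)

lemma convergent_prod_qpoch:
  fixes a p :: real
  assumes "0 \<le> p" "p < 1"
  shows "convergent_prod (\<lambda>k. 1 - a * p ^ k)"
proof -
  have "summable (\<lambda>k. norm (1 - a * p ^ k - 1))"
    using assms by (simp add: abs_mult summable_mult summable_geometric)
  then show ?thesis
    by (intro abs_convergent_prod_imp_convergent_prod summable_imp_abs_convergent_prod)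
qed

lemma qpoch_LIMSEQ:
  fixes a p :: real
  assumes "0 \<le> p" "p < 1"
  shows "(\<lambda>n. qpoch a p n) \<longlonglongrightarrow> qpoch_inf a p"
proof -
  have "(\<lambda>n. \<Prod>k\<le>n. 1 - a * p ^ k) \<longlonglongrightarrow> qpoch_inf a p"
    unfolding qpoch_inf_def by (intro convergent_prod_LIMSEQ convergent_prod_qpoch assms)
  then show ?thesis
    by (simp add: LIMSEQ_lessThan_iff_atMost qpoch_def)
qed

lemma qpoch_inf_split:
  fixes a p :: real
  assumes "0 \<le> p" "p < 1"
  shows "qpoch_inf a p = qpoch a p n * qpoch_inf (a * p ^ n) p"
proof -
  have "(\<lambda>k. qpoch a p (k + n)) \<longlonglongrightarrow> qpoch_inf a p"
    using qpoch_LIMSEQ[OF assms] by (rule LIMSEQ_ignore_initial_segment)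
  moreover have "(\<lambda>k. qpoch a p (k + n)) \<longlonglongrightarrow> qpoch a p n * qpoch_inf (a * p ^ n) p"
    unfolding add.commute[of _ n] qpoch_add
    by (intro tendsto_mult tendsto_const qpoch_LIMSEQ assms)
  ultimately show ?thesis by (rule LIMSEQ_unique)
qed

lemma qpoch_inf_nonneg:
  fixes a p :: real
  assumes "0 \<le> p" "p < 1" "a < 1"
  shows "0 \<le> qpoch_inf a p"
  by (rule LIMSEQ_le_const[OF qpoch_LIMSEQ[OF assms(1,2)]])
     (use assms in \<open>auto intro!: exI less_imp_le qpoch_pos\<close>)

lemma qpoch_inf_le_1:
  fixes a p :: real
  assumes "0 \<le> p" "p < 1" "0 \<le> a" "a \<le> 1"
  shows "qpoch_inf a p \<le> 1"
  by (rule LIMSEQ_le_const2[OF qpoch_LIMSEQ[OF assms(1,2)]])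
     (use assms in \<open>auto intro!: exI qpoch_le_1\<close>)

lemma qpoch_inf_ge_1:
  fixes a p :: real
  assumes "0 \<le> p" "p < 1" "a \<le> 0"
  shows "1 \<le> qpoch_inf a p"
proof (rule LIMSEQ_le_const[OF qpoch_LIMSEQ[OF assms(1,2)]])
  have "1 \<le> qpoch a p n" for n
    unfolding qpoch_def using assms by (intro prod_ge_1) (auto simp: mult_nonpos_nonneg)
  then show "\<exists>N. \<forall>n\<ge>N. 1 \<le> qpoch a p n" by blast
qed

text \<open>A limit of positive partial products could still vanish; a product that is convergent in
  the sense of \<open>convergent_prod\<close> vanishes only through a factor.\<close>

lemma qpoch_inf_pos:
  fixes a p :: real
  assumes "0 \<le> p" "p < 1" "a < 1"
  shows "0 < qpoch_inf a p"
proof -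
  have "1 - a * p ^ k \<noteq> 0" for k
    using qpoch_pos[of p a "Suc k"] assms by (auto simp: qpoch_Suc)
  then have "qpoch_inf a p \<noteq> 0"
    unfolding qpoch_inf_def by (intro prodinf_nonzero convergent_prod_qpoch assms)
  with qpoch_inf_nonneg[OF assms] show ?thesis by simp
qed

text \<open>These are the Taylor coefficients of \<open>qpoch_inf x p\<close> in \<open>x\<close>;
  see \<open>euler_sums\<close>.\<close>

definition euler_coeff :: "real \<Rightarrow> nat \<Rightarrow> real" where
  "euler_coeff p k = (-1) ^ k * p ^ (k choose 2) / qpoch p p k"

text \<open>This is the functional equation \<open>E x = (1 - x) * E (x * p)\<close> read off
  coefficient by coefficient.\<close>

lemma euler_coeff_Suc:
  assumes "0 < p" "p < 1"
  shows "(1 - p ^ Suc k) * euler_coeff p (Suc k) = - (p ^ k * euler_coeff p k)"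
proof -
  have "qpoch p p k \<noteq> 0" "1 - p ^ Suc k \<noteq> 0"
    using qpoch_pos[of p p k] power_strict_decreasing[of 0 "Suc k" p] assms by auto
  moreover have "Suc k choose 2 = (k choose 2) + k"
    by (simp add: numeral_2_eq_2)
  ultimately show ?thesis
    by (simp add: euler_coeff_def qpoch_Suc power_add field_simps)
qed

text \<open>Consecutive terms have a ratio of modulus
  \<open>p ^ k * \<bar>x\<bar> / (1 - p ^ Suc k)\<close>, which tends to 0.\<close>

lemma summable_euler:
  assumes "0 < p" "p < 1"
  shows "summable (\<lambda>k. norm (euler_coeff p k * x ^ k))"
proof -
  have e: "euler_coeff p (Suc k) = - (p ^ k / (1 - p ^ Suc k)) * euler_coeff p k" for k
  proof -
    have "1 - p ^ Suc k \<noteq> 0" using power_strict_decreasing[of 0 "Suc k" p] assms by auto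
    then show ?thesis using euler_coeff_Suc[OF assms, of k] by (simp add: field_simps)
  qed
  have "(\<lambda>k. p ^ k * norm x / (1 - p)) \<longlonglongrightarrow> 0 * norm x / (1 - p)"
    by (intro tendsto_intros LIMSEQ_realpow_zero) (use assms in auto)
  then have "eventually (\<lambda>k. p ^ k * norm x / (1 - p) < 1/2) sequentially"
    by (rule order_tendstoD) simp
  then obtain N where N: "\<And>k. k \<ge> N \<Longrightarrow> p ^ k * norm x / (1 - p) < 1/2"
    unfolding eventually_sequentially by blast
  show ?thesis
  proof (rule summable_ratio_test[where c = "1/2" and N = N])
    fix k assume k: "N \<le> k"
    have "p ^ Suc k \<le> p ^ 1" using assms by (intro power_decreasing) auto
    then have le: "1 - p \<le> 1 - p ^ Suc k" by simp
    then have "\<bar>1 - p * p ^ k\<bar> = 1 - p * p ^ k"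
      using assms mult_le_one[of p "p ^ k"] by simp
    then have nrm: "norm (p ^ k / (1 - p ^ Suc k)) = p ^ k / (1 - p ^ Suc k)"
      using assms by simp
    have "norm (euler_coeff p (Suc k) * x ^ Suc k) =
        (p ^ k * norm x / (1 - p ^ Suc k)) * norm (euler_coeff p k * x ^ k)"
      unfolding e norm_mult norm_minus_cancel nrm by (simp add: abs_mult)
    also have "\<dots> \<le> (p ^ k * norm x / (1 - p)) * norm (euler_coeff p k * x ^ k)"
    proof (intro mult_right_mono divide_left_mono mult_pos_pos le)
      show "0 < 1 - p ^ Suc k" "0 < 1 - p" using le assms by linarith+
    qed (use assms in auto)
    also have "\<dots> \<le> 1/2 * norm (euler_coeff p k * x ^ k)"
      using N[OF k] by (intro mult_right_mono) auto
    finally show "norm (norm (euler_coeff p (Suc k) * x ^ Suc k)) \<le> 1/2 * norm (norm (euler_coeff p k * x ^ k))"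
      by simp
  qed simp
qed

text \<open>The series solves \<open>E x = (1 - x) * E (x * p)\<close>. Iteration gives
  \<open>E x = qpoch x p n * E (x * p ^ n)\<close>, and as \<open>n\<close> grows the last factor
  tends to \<open>E 0 = 1\<close> by continuity.\<close>

theorem euler_sums:
  assumes "0 < p" "p < 1"
  shows "(\<lambda>k. euler_coeff p k * x ^ k) sums qpoch_inf x p"
proof -
  define E where "E x = (\<Sum>k. euler_coeff p k * x ^ k)" for x
  have sm: "summable (\<lambda>k. euler_coeff p k * x ^ k)" for x
    using summable_euler[OF assms] by (rule summable_norm_cancel)
  have step: "E x = (1 - x) * E (x * p)" for x
  proof -
    have t: "euler_coeff p (Suc k) * x ^ Suc k =
        euler_coeff p (Suc k) * (x * p) ^ Suc k - x * (euler_coeff p k * (x * p) ^ k)" for k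
      using arg_cong[OF euler_coeff_Suc[OF assms, of k], of "\<lambda>z. z * x ^ Suc k"]
      by (simp add: algebra_simps power_mult_distrib)
    have "E x = euler_coeff p 0 + (\<Sum>k. euler_coeff p (Suc k) * x ^ Suc k)"
      unfolding E_def using suminf_split_head[OF sm[of x]] by simp
    also have "(\<Sum>k. euler_coeff p (Suc k) * x ^ Suc k) =
      (\<Sum>k. euler_coeff p (Suc k) * (x * p) ^ Suc k) - (\<Sum>k. x * (euler_coeff p k * (x * p) ^ k))"
      unfolding t
      by (intro suminf_diff[symmetric] summable_mult sm) (subst summable_Suc_iff, rule sm)
    also have "(\<Sum>k. euler_coeff p (Suc k) * (x * p) ^ Suc k) = E (x * p) - euler_coeff p 0"
      unfolding E_def using suminf_split_head[OF sm[of "x * p"]] by simp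
    also have "(\<Sum>k. x * (euler_coeff p k * (x * p) ^ k)) = x * E (x * p)"
      unfolding E_def by (intro suminf_mult sm)
    finally show ?thesis by (simp add: algebra_simps)
  qed
  have iter: "E x = qpoch x p n * E (x * p ^ n)" for n
  proof (induction n)
    case (Suc n)
    then show ?case using step[of "x * p ^ n"] by (simp add: qpoch_Suc mult_ac)
  qed simp
  have "isCont E 0"
    unfolding E_def using sm[of 1] by (intro isCont_powser[where K = 1]) auto
  moreover have "(\<lambda>n. x * p ^ n) \<longlonglongrightarrow> 0"
    using assms by (auto intro!: tendsto_mult_right_zero LIMSEQ_realpow_zero)
  ultimately have "(\<lambda>n. E (x * p ^ n)) \<longlonglongrightarrow> E 0"
    by (rule isCont_tendsto_compose)
  then have "(\<lambda>n. qpoch x p n * E (x * p ^ n)) \<longlonglongrightarrow> qpoch_inf x p * E 0"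
    using assms by (intro tendsto_mult qpoch_LIMSEQ) auto
  then have "E x = qpoch_inf x p * E 0"
    unfolding iter[symmetric] by (simp add: LIMSEQ_const_iff)
  moreover have "E 0 = 1"
    unfolding E_def by (subst powser_zero) (simp add: euler_coeff_def binomial_eq_0)
  ultimately show ?thesis
    using summable_sums[OF sm[of x]] by (simp add: E_def)
qed

corollary euler_has_sum:
  assumes "0 < p" "p < 1"
  shows "((\<lambda>k. euler_coeff p k * x ^ k) has_sum qpoch_inf x p) UNIV"
  using summable_euler[OF assms] euler_sums[OF assms] by (rule norm_summable_imp_has_sum)

section \<open>Coefficients of the reciprocal product\<close>

text \<open>The power series coefficients of \<open>1 / qpoch_inf x p\<close>, extended by zero to
  negative indices.\<close>

definition recip_qpoch :: "real \<Rightarrow> int \<Rightarrow> real" where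
  "recip_qpoch p j = (if j < 0 then 0 else 1 / qpoch p p (nat j))"

text \<open>The zero extension fits: for \<open>j < 0\<close> the exponents
  \<open>j + 1, j + 2, ...\<close> pass through 0 and a factor vanishes, while for
  \<open>j \<ge> 0\<close> the first \<open>j\<close> factors of \<open>qpoch_inf p p\<close> are
  split off.\<close>

lemma qpoch_inf_powi:
  assumes "0 < p" "p < 1"
  shows "qpoch_inf (p powi (j + 1)) p = qpoch_inf p p * recip_qpoch p j"
proof (cases "j < 0")
  case True
  define m where "m = nat (- (j + 1))"
  have "p powi (j + 1) * p ^ m = 1"
    using True assms by (simp add: m_def power_int_def field_simps)
  then have "qpoch (p powi (j + 1)) p (Suc m) = 0"
    by (simp add: qpoch_Suc)
  then show ?thesis
    using True qpoch_inf_split[of p "p powi (j + 1)" "Suc m"] assms by (simp add: recip_qpoch_def)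
next
  case False
  then have "p powi (j + 1) = p * p ^ nat j"
    by (simp add: power_int_def nat_add_distrib)
  then show ?thesis
    using False qpoch_inf_split[of p p "nat j"] qpoch_pos[of p p "nat j"] assms
    by (simp add: recip_qpoch_def)
qed

text \<open>By \<open>qpoch_inf_powi\<close> the upper bound says that
  \<open>qpoch_inf (p powi (j + 1)) p\<close> is at most 1. Being uniform in \<open>j\<close>, it
  later yields the bound on the kernel.\<close>

lemma recip_qpoch_bounds:
  assumes "0 < p" "p < 1"
  shows "0 \<le> recip_qpoch p j" "recip_qpoch p j \<le> 1 / qpoch_inf p p"
proof -
  show "0 \<le> recip_qpoch p j"
    using qpoch_pos[of p p "nat j"] assms by (auto simp: recip_qpoch_def)
  have pos: "0 < qpoch_inf p p"
    using assms by (intro qpoch_inf_pos) auto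
  show "recip_qpoch p j \<le> 1 / qpoch_inf p p"
  proof (cases "j < 0")
    case False
    have "p powi (j + 1) \<le> 1"
      using False assms by (simp add: power_int_def power_le_one)
    then have "qpoch_inf (p powi (j + 1)) p \<le> 1"
      using assms by (intro qpoch_inf_le_1) auto
    then show ?thesis
      unfolding qpoch_inf_powi[OF assms] using pos by (simp add: field_simps)
  qed (use pos in \<open>simp add: recip_qpoch_def\<close>)
qed

section \<open>The Hahn--Exton kernel\<close>

text \<open>Coefficientwise, the product of \<open>qpoch_inf x p\<close> and its reciprocal is 1.
  Splitting \<open>1 - p ^ n\<close> as \<open>(1 - p ^ l) + p ^ l * (1 - p ^ (n - l))\<close> lets
  the recurrences of both coefficient sequences act, after which the two parts cancel.\<close>

lemma sum_euler_coeff_recip: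
  assumes p: "0 < p" "p < 1"
  shows "(\<Sum>l\<le>n. euler_coeff p l / qpoch p p (n - l)) = (if n = 0 then 1 else 0)"
proof (cases n)
  case 0
  then show ?thesis by (simp add: euler_coeff_def binomial_eq_0)
next
  case (Suc m)
  define r where "r k = 1 / qpoch p p k" for k
  have ne: "1 - p ^ Suc k \<noteq> 0" for k
    using power_strict_decreasing[of 0 "Suc k" p] p by auto
  have r: "(1 - p ^ Suc k) * r (Suc k) = r k" for k
    using ne[of k] qpoch_pos[of p p k] p by (simp add: r_def qpoch_Suc field_simps)
  have "(1 - p ^ n) * (\<Sum>l\<le>n. euler_coeff p l * r (n - l)) =
      (\<Sum>l\<le>n. (1 - p ^ l) * euler_coeff p l * r (n - l)) +
      (\<Sum>l\<le>n. p ^ l * euler_coeff p l * ((1 - p ^ (n - l)) * r (n - l)))"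
    unfolding sum_distrib_left sum.distrib[symmetric]
  proof (rule sum.cong)
    fix l assume "l \<in> {..n}"
    then have "p ^ n = p ^ l * p ^ (n - l)" by (simp flip: power_add)
    then show "(1 - p ^ n) * (euler_coeff p l * r (n - l)) = (1 - p ^ l) * euler_coeff p l * r (n - l) +
        p ^ l * euler_coeff p l * ((1 - p ^ (n - l)) * r (n - l))"
      by (simp add: algebra_simps)
  qed simp
  also have "(\<Sum>l\<le>n. (1 - p ^ l) * euler_coeff p l * r (n - l)) =
      (\<Sum>l\<le>m. - (p ^ l * euler_coeff p l) * r (m - l))"
    unfolding Suc sum.atMost_Suc_shift euler_coeff_Suc[OF p] by simp
  also have "(\<Sum>l\<le>n. p ^ l * euler_coeff p l * ((1 - p ^ (n - l)) * r (n - l))) =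
      (\<Sum>l\<le>m. p ^ l * euler_coeff p l * r (m - l))"
    unfolding Suc sum.atMost_Suc
    by (auto simp: Suc_diff_le r[simplified] intro!: sum.cong)
  finally show ?thesis
    using ne[of m] Suc by (simp add: r_def sum_negf)
qed

text \<open>
  Expanding \<open>(w p\<^sup>k; p)\<^sub>\<infinity>\<close> by Euler's identity and interchanging the sums turns the
  Hahn--Exton series into the correlation of the coefficients of \<open>(w x; p)\<^sub>\<infinity>\<close> with
  those of \<open>1 / (x; p)\<^sub>\<infinity>\<close>.
\<close>

theorem qbessel_j_has_sum:
  fixes q v :: real and n :: int
  assumes q: "0 < q" "q < 1" and v: "v > -1"
  defines "p \<equiv> q\<^sup>2" and "w \<equiv> q powr (2 * v + 2)"
  shows "((\<lambda>l. euler_coeff p l * w ^ l * recip_qpoch p (n + int l)) has_sum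
           qpoch_inf w p / qpoch_inf p p * qbessel_j q v (q powi n)) UNIV"
proof -
  \<comment> \<open>With this \<open>z\<close>, the Hahn-Exton factor
    \<open>q ^ (k * (k + 1)) * (q powi n) ^ (2 * k)\<close> is
    \<open>p ^ (k choose 2) * z ^ k\<close>.\<close>
  define z where "z = p powi (n + 1)"
  define g where "g = (\<lambda>(k, l). euler_coeff p k * z ^ k * (euler_coeff p l * w ^ l) * p ^ (k * l))"
  have p: "0 < p" "p < 1"
    using q by (auto simp: p_def power_less_one_iff)
  have w: "0 < w" "w < 1"
    using q v powr_less_mono'[of q 0 "2 * v + 2"] by (auto simp: w_def)
  have eul: "((\<lambda>k. euler_coeff p k * x ^ k) has_sum qpoch_inf x p) UNIV" for x
    using euler_has_sum[OF p] .
  then have abs: "(\<lambda>k. \<bar>euler_coeff p k * x ^ k\<bar>) summable_on UNIV" for x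
    by (intro summable_on_abs has_sum_imp_summable)
  \<comment> \<open>As \<open>p ^ (k * l) \<le> 1\<close>, a product of two absolutely convergent
    Euler series dominates \<open>g\<close>; this permits both orders of summation.\<close>
  have "g summable_on UNIV \<times> UNIV"
  proof (rule summable_on_bound[OF summable_on_times[OF abs[of z] abs[of w]]])
    fix x :: "nat \<times> nat"
    obtain k l where x: "x = (k, l)" by (cases x)
    have "p ^ (k * l) \<le> 1" using p by (simp add: power_le_one)
    then show "\<bar>g x\<bar> \<le> (case x of (k, l) \<Rightarrow> \<bar>euler_coeff p k * z ^ k\<bar> * \<bar>euler_coeff p l * w ^ l\<bar>)"
      using p mult_left_mono[of "p ^ (k * l)" 1 "\<bar>euler_coeff p k * z ^ k * (euler_coeff p l * w ^ l)\<bar>"]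
      by (simp add: x g_def abs_mult)
  qed
  then obtain S where S: "(g has_sum S) (UNIV \<times> UNIV)"
    by (auto simp: summable_on_def)
  \<comment> \<open>Summing over \<open>l\<close> first gives the Hahn-Exton series, since
    \<open>qpoch_inf (w * p ^ k) p\<close> is \<open>qpoch_inf w p / qpoch w p k\<close>.\<close>
  have "((\<lambda>l. g (k, l)) has_sum (euler_coeff p k * z ^ k * qpoch_inf (w * p ^ k) p)) UNIV" for k
    using has_sum_cmult_right[OF eul, of "euler_coeff p k * z ^ k" "w * p ^ k"]
    by (simp add: g_def power_mult_distrib mult_ac flip: power_mult)
  from has_sum_imp_sums[OF has_sum_Sigma'[OF S this]]
  have "(\<lambda>k. euler_coeff p k * z ^ k * qpoch_inf (w * p ^ k) p) sums S"
    by simp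
  moreover have "euler_coeff p k * z ^ k * qpoch_inf (w * p ^ k) p = qpoch_inf w p *
      ((-1) ^ k * (q ^ (k * (k + 1)) / (qpoch w p k * qpoch p p k)) * (q powi n) ^ (2 * k))" for k
  proof -
    have "qpoch_inf w p = qpoch w p k * qpoch_inf (w * p ^ k) p"
      using p by (intro qpoch_inf_split) auto
    moreover have "qpoch w p k \<noteq> 0"
      using qpoch_pos[of p w k] p w by auto
    moreover have "z ^ k = p ^ k * (q powi n) ^ (2 * k)"
      using q by (simp add: z_def p_def power_int_add power_mult_distrib power_int_mult_distrib
           power2_eq_square power_mult)
    moreover have "p ^ (k choose 2) * p ^ k = q ^ (k * (k + 1))"
    proof -
      have "2 * (k choose 2) + 2 * k = k * (k + 1)"
        by (induction k) (auto simp: numeral_2_eq_2)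
      then have "q ^ (2 * (k choose 2) + 2 * k) = q ^ (k * (k + 1))" by (rule arg_cong)
      then show ?thesis by (simp only: p_def power_mult power_add)
    qed
    ultimately show ?thesis
      by (simp add: euler_coeff_def field_simps)
  qed
  ultimately have "(\<lambda>k. qpoch_inf w p *
      ((-1) ^ k * (q ^ (k * (k + 1)) / (qpoch w p k * qpoch p p k)) * (q powi n) ^ (2 * k))) sums S"
    by simp
  moreover have w0: "qpoch_inf w p \<noteq> 0" and p0: "qpoch_inf p p \<noteq> 0"
    using qpoch_inf_pos[of p w] qpoch_inf_pos[of p p] p w by auto
  ultimately have "(\<lambda>k. (-1) ^ k * (q ^ (k * (k + 1)) / (qpoch w p k * qpoch p p k)) * (q powi n) ^ (2 * k))
      sums (S / qpoch_inf w p)"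
    by (intro sums_mult_D[where c = "qpoch_inf w p"]) (simp only: mult.assoc)
  from sums_unique[OF this] have "qbessel_j q v (q powi n) = S / qpoch_inf w p"
    unfolding qbessel_j_def p_def w_def by (rule sym)
  then have Sj: "S = qpoch_inf w p * qbessel_j q v (q powi n)"
    using w0 by simp
  \<comment> \<open>Summing over \<open>k\<close> first gives
    \<open>qpoch_inf (p powi (n + int l + 1)) p\<close>, a multiple of a reciprocal
    coefficient.\<close>
  have inner: "((\<lambda>k. g (k, l)) has_sum (euler_coeff p l * w ^ l * (qpoch_inf p p * recip_qpoch p (n + int l)))) UNIV" for l
  proof -
    have "z * p ^ l = p powi (n + int l + 1)"
      using p by (simp add: z_def power_int_add)
    then have "qpoch_inf (z * p ^ l) p = qpoch_inf p p * recip_qpoch p (n + int l)"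
      using qpoch_inf_powi[OF p] by simp
    moreover have "(z * p ^ l) ^ k = z ^ k * p ^ (k * l)" for k
      by (simp add: power_mult_distrib power_mult mult.commute[of k])
    ultimately show ?thesis
      using has_sum_cmult_right[OF eul, of "euler_coeff p l * w ^ l" "z * p ^ l"]
      by (simp add: g_def mult_ac)
  qed
  have "((\<lambda>(l, k). g (k, l)) has_sum S) (UNIV \<times> UNIV)"
    using S unfolding has_sum_swap[of g] .
  then have "((\<lambda>l. euler_coeff p l * w ^ l * (qpoch_inf p p * recip_qpoch p (n + int l))) has_sum S) UNIV"
    by (rule has_sum_Sigma') (simp only: prod.case inner)
  from has_sum_cmult_left[OF this, of "1 / qpoch_inf p p"] show ?thesis
    using p0 by (simp add: Sj mult_ac)
qed

text \<open>
  With \<open>A'\<close> and \<open>b'\<close> the reflections of \<open>A\<close> and \<open>b\<close> and \<open>A * b\<close> the unit of convolution,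
  \<open>u = A' * b\<close>, so that its autocorrelation \<open>u' * u = (A * b) * (A * b)'\<close> is the unit again.
\<close>

lemma autocorrelation_of_inverse_pair:
  fixes A b :: "int \<Rightarrow> real"
  defines "u \<equiv> \<lambda>n. \<Sum>\<^sub>\<infinity>l. A l * b (n + l)"
  assumes A: "A summable_on UNIV" and b: "b summable_on UNIV"
    and conv: "\<And>n. (\<Sum>\<^sub>\<infinity>l. A l * b (n - l)) = (if n = 0 then 1 else 0)"
  shows "u summable_on UNIV"
    and "(\<Sum>\<^sub>\<infinity>n. u n * u (n + k)) = (if k = 0 then 1 else 0)"
proof -
  show u: "u summable_on UNIV"
    using summable_on_Sigma_banach[OF summable_on_correlation[OF A b]] by (simp add: u_def)
  obtain Kb where Kb: "\<And>n. \<bar>b n\<bar> \<le> Kb" using summable_on_bounded[OF b] by blast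
  obtain Ku where Ku: "\<And>n. \<bar>u n\<bar> \<le> Ku" using summable_on_bounded[OF u] by blast
  \<comment> \<open>In terms of convolution, \<open>A * u = A * A' * b = A'\<close>.\<close>
  have inner: "(\<Sum>\<^sub>\<infinity>l. A l * u (j - l)) = A (- j)" for j
  proof -
    have "(\<lambda>z. (case z of (l, m) \<Rightarrow> A l * A m) * b (case z of (l, m) \<Rightarrow> j - l + m)) summable_on UNIV \<times> UNIV"
      by (rule summable_on_mult_bounded[OF summable_on_times[OF A A]]) (rule Kb)
    then have sm: "(\<lambda>(l, m). A l * (A m * b (j - l + m))) summable_on UNIV \<times> UNIV"
      by (simp add: case_prod_unfold mult_ac)
    have "(\<Sum>\<^sub>\<infinity>l. A l * u (j - l)) = (\<Sum>\<^sub>\<infinity>l. \<Sum>\<^sub>\<infinity>m. A l * (A m * b (j - l + m)))"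
      by (simp add: u_def infsum_cmult_right')
    also have "\<dots> = (\<Sum>\<^sub>\<infinity>m. \<Sum>\<^sub>\<infinity>l. A l * (A m * b (j - l + m)))"
      by (rule infsum_swap_banach[OF sm])
    also have "\<dots> = (\<Sum>\<^sub>\<infinity>m. A m * (\<Sum>\<^sub>\<infinity>l. A l * b (j + m - l)))"
      by (subst infsum_cmult_right'[symmetric]) (simp add: algebra_simps)
    also have "\<dots> = (\<Sum>\<^sub>\<infinity>m. if m = - j then A m else 0)"
      unfolding conv by (rule infsum_cong) auto
    also have "\<dots> = (\<Sum>\<^sub>\<infinity>m\<in>{- j}. A m)"
      by (rule infsum_cong_neutral) auto
    finally show ?thesis by simp
  qed
  have "(\<lambda>z. (case z of (n, l) \<Rightarrow> A l * b (n + l)) * u (case z of (n, l) \<Rightarrow> n + k)) summable_on UNIV \<times> UNIV"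
    by (rule summable_on_mult_bounded[OF summable_on_correlation[OF A b]]) (rule Ku)
  then have sm1: "(\<lambda>(n, l). A l * (b (n + l) * u (n + k))) summable_on UNIV \<times> UNIV"
    by (simp add: case_prod_unfold mult_ac)
  have "(\<lambda>z. (case z of (l, m) \<Rightarrow> A l * b m) * u (case z of (l, m) \<Rightarrow> m + k - l)) summable_on UNIV \<times> UNIV"
    by (rule summable_on_mult_bounded[OF summable_on_times[OF A b]]) (rule Ku)
  then have sm2: "(\<lambda>(l, m). A l * (b m * u (m + k - l))) summable_on UNIV \<times> UNIV"
    by (simp add: case_prod_unfold mult_ac)
  have "u n * x = (\<Sum>\<^sub>\<infinity>l. A l * (b (n + l) * x))" for n x
    by (simp add: u_def mult.assoc flip: infsum_cmult_left')
  then have "(\<Sum>\<^sub>\<infinity>n. u n * u (n + k)) = (\<Sum>\<^sub>\<infinity>n. \<Sum>\<^sub>\<infinity>l. A l * (b (n + l) * u (n + k)))"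
    by simp
  also have "\<dots> = (\<Sum>\<^sub>\<infinity>l. \<Sum>\<^sub>\<infinity>n. A l * (b (n + l) * u (n + k)))"
    by (rule infsum_swap_banach[OF sm1])
  also have "\<dots> = (\<Sum>\<^sub>\<infinity>l. \<Sum>\<^sub>\<infinity>m. A l * (b m * u (m + k - l)))"
    using infsum_shift(1)[of "\<lambda>m. A l * (b m * u (m + k - l))" l for l] by (simp add: algebra_simps)
  also have "\<dots> = (\<Sum>\<^sub>\<infinity>m. \<Sum>\<^sub>\<infinity>l. A l * (b m * u (m + k - l)))"
    by (rule infsum_swap_banach[OF sm2])
  also have "\<dots> = (\<Sum>\<^sub>\<infinity>m. b m * (\<Sum>\<^sub>\<infinity>l. A l * u (m + k - l)))"
    by (subst infsum_cmult_right'[symmetric]) (simp add: mult_ac)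
  also have "\<dots> = (\<Sum>\<^sub>\<infinity>m. b m * A (- k - m))"
  proof -
    have "- (m + k) = - k - m" for m by simp
    then show ?thesis by (simp only: inner)
  qed
  also have "\<dots> = (\<Sum>\<^sub>\<infinity>l. A l * b (- k - l))"
    using infsum_shift(2)[of "\<lambda>m. b m * A (- k - m)" "- k"] by (simp add: mult_ac)
  finally show "(\<Sum>\<^sub>\<infinity>n. u n * u (n + k)) = (if k = 0 then 1 else 0)"
    by (simp add: conv)
qed

section \<open>The kernel of the transform on sequences\<close>

lemma c_const_eq:
  "(1 - q) * c_const q v = qpoch_inf (q powr (2 * v + 2)) (q\<^sup>2) / qpoch_inf (q\<^sup>2) (q\<^sup>2)" if "q < 1"
  using that by (simp add: c_const_def)

text \<open>The measure \<open>x powr (2 * v + 1)\<close> has at \<open>q powi m\<close>, up to the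
  factor \<open>1 - q\<close>, the mass \<open>((q powr (v + 1)) powi m)\<^sup>2\<close>. Weighting
  input and output values by the root of the mass makes the kernel depend on \<open>n + m\<close>
  alone.\<close>

definition bessel_kernel :: "real \<Rightarrow> real \<Rightarrow> int \<Rightarrow> real" where
  "bessel_kernel q v n = (1 - q) * c_const q v * (q powr (v + 1)) powi n * qbessel_j q v (q powi n)"

text \<open>With \<open>s = q powr (v + 1)\<close> one has \<open>w = s * s\<close>, and the two
  factors \<open>s\<close> are shared out: \<open>A\<close> holds the coefficients of
  \<open>qpoch_inf (s * x) p\<close> and \<open>b\<close> those of its reciprocal. Thus
  \<open>A\<close> and \<open>b\<close> are inverse under convolution, and the kernel is their
  correlation.\<close>

lemma
  fixes q v :: real
  assumes q: "0 < q" "q < 1" and v: "v > -1"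
  shows summable_bessel_kernel: "bessel_kernel q v summable_on UNIV"
    and autocorrelation_bessel_kernel:
      "(\<Sum>\<^sub>\<infinity>n. bessel_kernel q v n * bessel_kernel q v (n + k)) = (if k = 0 then 1 else 0)"
    and abs_bessel_kernel_le:
      "\<bar>bessel_kernel q v n\<bar> \<le> (1 - q) * B_const q v * (q powr (v + 1)) powi n"
proof -
  define p where "p = q\<^sup>2"
  define s where "s = q powr (v + 1)"
  define w where "w = q powr (2 * v + 2)"
  define A where "A l = (if l < 0 then 0 else euler_coeff p (nat l) * s ^ nat l)" for l :: int
  define b where "b j = s powi j * recip_qpoch p j" for j
  have p: "0 < p" "p < 1"
    using q by (auto simp: p_def power_less_one_iff)
  have s: "0 < s" "s < 1"
    using q v powr_less_mono'[of q 0 "v + 1"] by (auto simp: s_def)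
  have w: "w = s * s"
    by (simp add: w_def s_def flip: powr_add)
  have w0: "0 < w"
    using s by (simp add: w)
  have P0: "0 < qpoch_inf p p"
    using p by (intro qpoch_inf_pos) auto
  have A: "A summable_on UNIV"
    unfolding summable_on_def
    by (rule exI, subst has_sum_int_nat) (auto simp: A_def intro!: euler_has_sum p)
  have "(\<lambda>n. b (int n)) summable_on UNIV"
  proof (rule summable_on_bound)
    have "summable (\<lambda>n. norm (s ^ n * (1 / qpoch_inf p p)))"
      using s by (simp add: norm_mult norm_power norm_divide summable_mult2 summable_geometric summable_divide)
    then show "(\<lambda>n. s ^ n * (1 / qpoch_inf p p)) summable_on UNIV"
      by (rule norm_summable_imp_summable_on)
    fix n
    have "\<bar>b (int n)\<bar> = s ^ n * recip_qpoch p (int n)"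
      using recip_qpoch_bounds[OF p, of "int n"] s by (simp add: b_def abs_mult)
    also have "\<dots> \<le> s ^ n * (1 / qpoch_inf p p)"
      using s by (intro mult_left_mono recip_qpoch_bounds p) auto
    finally show "\<bar>b (int n)\<bar> \<le> s ^ n * (1 / qpoch_inf p p)" .
  qed
  then have b: "b summable_on UNIV"
    unfolding summable_on_def by (subst has_sum_int_nat) (auto simp: b_def recip_qpoch_def)
  have conv: "(\<Sum>\<^sub>\<infinity>l. A l * b (n - l)) = (if n = 0 then 1 else 0)" for n
  proof (cases "n < 0")
    case True
    then have z: "A l * b (n - l) = 0" for l
      by (auto simp: A_def b_def recip_qpoch_def)
    show ?thesis unfolding z using True by simp
  next
    case False
    then obtain m where m: "n = int m" by (metis nonneg_int_cases not_less)
    have "((\<lambda>l. A (int l) * b (n - int l)) has_sum (\<Sum>l\<le>m. A (int l) * b (n - int l))) UNIV"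
      by (rule has_sum_finite_neutralI[where B = "{..m}"]) (auto simp: m b_def recip_qpoch_def)
    then have "((\<lambda>l. A l * b (n - l)) has_sum (\<Sum>l\<le>m. A (int l) * b (n - int l))) UNIV"
      by (subst has_sum_int_nat) (auto simp: A_def)
    also have "(\<Sum>l\<le>m. A (int l) * b (n - int l)) = (\<Sum>l\<le>m. s ^ m * (euler_coeff p l / qpoch p p (m - l)))"
    proof (rule sum.cong)
      fix l assume "l \<in> {..m}"
      then have "b (n - int l) = s ^ (m - l) / qpoch p p (m - l)" and "s ^ m = s ^ l * s ^ (m - l)"
        by (auto simp: m b_def recip_qpoch_def simp flip: power_add of_nat_diff)
      then show "A (int l) * b (n - int l) = s ^ m * (euler_coeff p l / qpoch p p (m - l))"
        by (simp add: A_def)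
    qed simp
    also have "\<dots> = (if n = 0 then 1 else 0)"
      unfolding sum_distrib_left[symmetric] sum_euler_coeff_recip[OF p] by (simp add: m)
    finally show ?thesis by (rule infsumI)
  qed
  have Ab: "A (int l) * b (n + int l) = s powi n * (euler_coeff p l * w ^ l * recip_qpoch p (n + int l))" for n l
    using s by (simp add: A_def b_def w power_int_add power_mult_distrib)
  have K: "bessel_kernel q v n = s powi n * (qpoch_inf w p / qpoch_inf p p * qbessel_j q v (q powi n))" for n
    unfolding bessel_kernel_def c_const_eq[OF q(2)] p_def w_def s_def by (simp only: mult_ac)
  have u: "bessel_kernel q v = (\<lambda>n. \<Sum>\<^sub>\<infinity>l. A l * b (n + l))"
  proof
    fix n
    have "((\<lambda>l. A (int l) * b (n + int l)) has_sum bessel_kernel q v n) UNIV"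
      unfolding Ab K p_def w_def by (intro has_sum_cmult_right qbessel_j_has_sum q v)
    then have "((\<lambda>l. A l * b (n + l)) has_sum bessel_kernel q v n) UNIV"
      by (subst has_sum_int_nat) (auto simp: A_def)
    then show "bessel_kernel q v n = (\<Sum>\<^sub>\<infinity>l. A l * b (n + l))"
      by (rule infsumI[symmetric])
  qed
  show "bessel_kernel q v summable_on UNIV"
    and "(\<Sum>\<^sub>\<infinity>n. bessel_kernel q v n * bessel_kernel q v (n + k)) = (if k = 0 then 1 else 0)"
    unfolding u using autocorrelation_of_inverse_pair[OF A b conv] by auto
  \<comment> \<open>The Euler coefficients alternate in sign, so their absolute values give the
    series at \<open>- w\<close>; the reciprocal coefficients are replaced by their uniform
    bound.\<close>
  have "\<bar>qpoch_inf w p / qpoch_inf p p * qbessel_j q v (q powi n)\<bar> \<le> qpoch_inf (- w) p * (1 / qpoch_inf p p)"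
  proof (rule norm_infsum_le[where 'b = real, unfolded real_norm_def])
    show "((\<lambda>l. euler_coeff p l * w ^ l * recip_qpoch p (n + int l)) has_sum
             qpoch_inf w p / qpoch_inf p p * qbessel_j q v (q powi n)) UNIV"
      using qbessel_j_has_sum[OF q v] by (simp add: p_def w_def)
    show "((\<lambda>l. euler_coeff p l * (- w) ^ l * (1 / qpoch_inf p p)) has_sum
             qpoch_inf (- w) p * (1 / qpoch_inf p p)) UNIV"
      by (intro has_sum_cmult_left euler_has_sum p)
    fix l :: nat
    have "\<bar>euler_coeff p l\<bar> = (-1) ^ l * euler_coeff p l"
      using qpoch_pos[of p p l] p by (simp add: euler_coeff_def abs_mult flip: mult.assoc power_add)
    then have "\<bar>euler_coeff p l * w ^ l\<bar> = euler_coeff p l * (- w) ^ l"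
      using w0 by (simp add: abs_mult power_minus[of w])
    moreover have "\<bar>recip_qpoch p (n + int l)\<bar> \<le> 1 / qpoch_inf p p"
      using recip_qpoch_bounds[OF p] by simp
    ultimately show "\<bar>euler_coeff p l * w ^ l * recip_qpoch p (n + int l)\<bar> \<le>
        euler_coeff p l * (- w) ^ l * (1 / qpoch_inf p p)"
      unfolding abs_mult[of "euler_coeff p l * w ^ l"] by (metis abs_ge_zero mult_left_mono)
  qed
  \<comment> \<open>\<open>B_const\<close> carries the further factor
    \<open>qpoch_inf (- p) p\<close>, which is at least 1.\<close>
  also have "\<dots> \<le> (1 - q) * B_const q v"
  proof -
    have "1 \<le> qpoch_inf (- p) p" "0 \<le> qpoch_inf (- w) p"
      using p w0 by (auto intro!: qpoch_inf_ge_1 qpoch_inf_nonneg)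
    then have "qpoch_inf (- w) p / qpoch_inf p p \<le> qpoch_inf (- p) p * qpoch_inf (- w) p / qpoch_inf p p"
      using P0 mult_right_mono[of 1 "qpoch_inf (- p) p" "qpoch_inf (- w) p"]
      by (intro divide_right_mono) auto
    then show ?thesis
      using q by (simp add: B_const_def p_def w_def)
  qed
  finally have bound: "\<bar>qpoch_inf w p / qpoch_inf p p * qbessel_j q v (q powi n)\<bar> \<le> (1 - q) * B_const q v" .
  have "\<bar>bessel_kernel q v n\<bar> = s powi n * \<bar>qpoch_inf w p / qpoch_inf p p * qbessel_j q v (q powi n)\<bar>"
    unfolding K abs_mult[of "s powi n"] using s by (simp only: abs_of_pos zero_less_power_int)
  also have "\<dots> \<le> s powi n * ((1 - q) * B_const q v)"
    using s by (intro mult_left_mono bound) auto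
  finally show "\<bar>bessel_kernel q v n\<bar> \<le> (1 - q) * B_const q v * (q powr (v + 1)) powi n"
    by (simp only: s_def mult_ac)
qed

section \<open>The isometry defined by a kernel with orthonormal translates\<close>

text \<open>Expand \<open>(\<psi> n)\<^sup>2\<close> as a double sum over \<open>i\<close> and
  \<open>j\<close>. Summing over \<open>n\<close> first leaves the autocorrelation
  \<open>r (j - i)\<close> of \<open>\<phi>\<close>; grouping by \<open>k = j - i\<close> then
  brings in the autocorrelation of \<open>u\<close>, and only \<open>r 0\<close>, the squared norm
  of \<open>\<phi>\<close>, survives.\<close>

lemma isometry_of_autocorrelation:
  fixes u \<phi> :: "int \<Rightarrow> real"
  defines "\<psi> \<equiv> \<lambda>n. \<Sum>\<^sub>\<infinity>m. u (n + m) * \<phi> m"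
  assumes u: "u summable_on UNIV"
    and ac: "\<And>k. (\<Sum>\<^sub>\<infinity>n. u n * u (n + k)) = (if k = 0 then 1 else 0)"
    and \<phi>: "(\<lambda>n. (\<phi> n)\<^sup>2) summable_on UNIV"
  shows "(\<lambda>m. u (n + m) * \<phi> m) summable_on UNIV"
    and "((\<lambda>n. (\<psi> n)\<^sup>2) has_sum (\<Sum>\<^sub>\<infinity>n. (\<phi> n)\<^sup>2)) UNIV"
proof -
  obtain K where "\<And>n. \<bar>(\<phi> n)\<^sup>2\<bar> \<le> K" using summable_on_bounded[OF \<phi>] by blast
  then have K: "\<bar>\<phi> n\<bar> \<le> sqrt K" for n
    using real_sqrt_le_mono[of "(\<phi> n)\<^sup>2" K] by simp
  have sm: "(\<lambda>m. u (n + m) * \<phi> m) summable_on UNIV" for n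
    by (rule summable_on_mult_bounded[OF _ K]) (simp add: summable_on_shift u)
  then show "(\<lambda>m. u (n + m) * \<phi> m) summable_on UNIV" .
  have \<psi>: "((\<lambda>i. u i * \<phi> (i - n)) has_sum \<psi> n) UNIV" for n
  proof -
    have "((\<lambda>m. u (n + m) * \<phi> m) has_sum \<psi> n) UNIV"
      using sm by (simp add: \<psi>_def)
    then show ?thesis
      by (subst has_sum_reindex_bij_witness[of _ "\<lambda>m. n + m" "\<lambda>i. i - n"]) auto
  qed
  define r where "r k = (\<Sum>\<^sub>\<infinity>m. \<phi> m * \<phi> (m + k))" for k
  define N where "N = 2 * (\<Sum>\<^sub>\<infinity>n. (\<phi> n)\<^sup>2)"
  define T where "T = (\<lambda>(n, i, j). u i * \<phi> (i - n) * (u j * \<phi> (j - n)))"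
  have shift: "(\<lambda>n. (\<phi> (i - n))\<^sup>2) summable_on UNIV" "(\<Sum>\<^sub>\<infinity>n. (\<phi> (i - n))\<^sup>2) = (\<Sum>\<^sub>\<infinity>n. (\<phi> n)\<^sup>2)" for i
    using \<phi> summable_on_shift(2)[of "\<lambda>n. (\<phi> n)\<^sup>2" i] infsum_shift(2)[of "\<lambda>n. (\<phi> n)\<^sup>2" i] by auto
  have prod: "(\<lambda>n. \<phi> (i - n) * \<phi> (j - n)) summable_on UNIV" for i j
    by (intro summable_on_times_squares shift)
  \<comment> \<open>Absolute convergence of the triple series: \<open>u i * u j\<close> is summable,
    and the inner sums over \<open>n\<close> are at most \<open>N\<close> by
    \<open>\<bar>x * y\<bar> \<le> x\<^sup>2 + y\<^sup>2\<close>.\<close>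
  have "(\<lambda>((i, j), n). T (n, i, j)) summable_on UNIV \<times> UNIV"
  proof (rule summable_on_bound)
    let ?R = "\<lambda>(i, j). \<Sum>\<^sub>\<infinity>n. \<bar>\<phi> (i - n) * \<phi> (j - n)\<bar>"
    show "(\<lambda>((i, j), n). \<bar>u i * u j\<bar> * \<bar>\<phi> (i - n) * \<phi> (j - n)\<bar>) summable_on UNIV \<times> UNIV"
    proof (rule summable_on_SigmaI[where g = "\<lambda>x. (case x of (i, j) \<Rightarrow> \<bar>u i * u j\<bar>) * ?R x"])
      fix x :: "int \<times> int"
      show "((\<lambda>n. (\<lambda>((i, j), n). \<bar>u i * u j\<bar> * \<bar>\<phi> (i - n) * \<phi> (j - n)\<bar>) (x, n)) has_sum
              (case x of (i, j) \<Rightarrow> \<bar>u i * u j\<bar>) * ?R x) UNIV"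
        using summable_on_abs[OF prod] by (cases x) (auto intro!: has_sum_cmult_right)
      show "(\<lambda>x. (case x of (i, j) \<Rightarrow> \<bar>u i * u j\<bar>) * ?R x) summable_on UNIV"
      proof (rule summable_on_mult_bounded)
        show "(\<lambda>(i, j). \<bar>u i * u j\<bar>) summable_on UNIV"
          using summable_on_abs[OF summable_on_times[OF u u]] by (simp add: case_prod_unfold)
        fix x :: "int \<times> int"
        obtain i j where x: "x = (i, j)" by (cases x)
        have "?R x \<le> (\<Sum>\<^sub>\<infinity>n. (\<phi> (i - n))\<^sup>2 + (\<phi> (j - n))\<^sup>2)"
          unfolding x prod.case
          by (intro infsum_mono summable_on_abs prod summable_on_add shift abs_mult_le_sum_squares)
        also have "\<dots> = N"
          by (subst infsum_add) (auto simp: shift N_def)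
        finally show "\<bar>?R x\<bar> \<le> N"
          by (simp add: x abs_of_nonneg infsum_nonneg)
      qed
    qed auto
  qed (auto simp: T_def abs_mult mult_ac)
  then obtain S where S: "((\<lambda>((i, j), n). T (n, i, j)) has_sum S) (UNIV \<times> UNIV)"
    by (auto simp: summable_on_def)
  then have S': "(T has_sum S) (UNIV \<times> UNIV)"
    by (subst has_sum_swap) (simp add: case_prod_unfold)
  have "((\<lambda>x. T (n, x)) has_sum (\<psi> n)\<^sup>2) UNIV" for n
    using has_sum_times[OF \<psi>[of n] \<psi>[of n]] by (simp add: T_def power2_eq_square case_prod_unfold)
  with S' have \<psi>S: "((\<lambda>n. (\<psi> n)\<^sup>2) has_sum S) UNIV"
    by (rule has_sum_Sigma')
  have "((\<lambda>n. T (n, i, j)) has_sum (u i * u j * r (j - i))) UNIV" for i j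
  proof -
    have "((\<lambda>n. \<phi> (i - n) * \<phi> (j - n)) has_sum (\<Sum>\<^sub>\<infinity>n. \<phi> (i - n) * \<phi> (j - n))) UNIV"
      using prod by simp
    also have "(\<Sum>\<^sub>\<infinity>n. \<phi> (i - n) * \<phi> (j - n)) = r (j - i)"
      using infsum_shift(2)[of "\<lambda>m. \<phi> m * \<phi> (m + (j - i))" i] by (simp add: r_def algebra_simps)
    finally show ?thesis
      using has_sum_cmult_right[of _ _ _ "u i * u j"] by (fastforce simp: T_def mult_ac)
  qed
  then have "((\<lambda>(i, j). u i * u j * r (j - i)) has_sum S) (UNIV \<times> UNIV)"
    using has_sum_Sigma'[OF S, of "\<lambda>(i, j). u i * u j * r (j - i)"] by (auto simp: case_prod_unfold)
  then have Sk: "((\<lambda>(k, i). r k * (u i * u (i + k))) has_sum S) (UNIV \<times> UNIV)"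
    by (subst has_sum_reindex_bij_witness[of _ "\<lambda>(i, j). (j - i, i)" "\<lambda>(k, i). (i, i + k)"]) auto
  obtain Ku where Ku: "\<And>n. \<bar>u n\<bar> \<le> Ku" using summable_on_bounded[OF u] by blast
  have acs: "((\<lambda>i. u i * u (i + k)) has_sum (if k = 0 then 1 else 0)) UNIV" for k
    using summable_on_mult_bounded[OF u Ku, of "\<lambda>i. i + k"] ac[of k] by (simp add: has_sum_iff)
  have "((\<lambda>k. r k * (if k = 0 then 1 else 0)) has_sum S) UNIV"
    by (rule has_sum_Sigma'[OF Sk]) (unfold prod.case, intro has_sum_cmult_right acs)
  moreover have "((\<lambda>k. r k * (if k = 0 then 1 else 0)) has_sum r 0) UNIV"
    by (rule has_sum_finite_neutralI[where B = "{0}"]) auto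
  ultimately have "S = r 0" by (rule has_sum_unique)
  with \<psi>S show "((\<lambda>n. (\<psi> n)\<^sup>2) has_sum (\<Sum>\<^sub>\<infinity>n. (\<phi> n)\<^sup>2)) UNIV"
    by (simp add: r_def power2_eq_square)
qed

section \<open>The Heinz inequality for finite sections\<close>

text \<open>
  Powers of \<open>R\<close> turn the bound \<open>L\<close> in the unweighted norm into the same bound in the
  weighted one: by Cauchy--Schwarz \<open>t = (x, R x) / (x, x)\<close> satisfies \<open>t\<^sup>N \<le> (x, R\<^sup>N x) / (x, x)\<close>
  for \<open>N = 2\<^sup>k\<close>, and the right-hand side is \<open>O(L\<^sup>N)\<close>.
\<close>

lemma symmetrizable_operator_bound:
  fixes S :: "'a set" and D :: "'a \<Rightarrow> real" and R :: "('a \<Rightarrow> real) \<Rightarrow> 'a \<Rightarrow> real"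
  defines "ip \<equiv> \<lambda>x y. \<Sum>j\<in>S. D j * x j * y j"
  assumes D: "\<And>j. j \<in> S \<Longrightarrow> 0 \<le> D j" "\<And>j. j \<in> S \<Longrightarrow> D j \<le> 1"
    and sym: "\<And>x y. ip x (R y) = ip (R x) y"
    and bound: "\<And>x. (\<Sum>j\<in>S. (R x j)\<^sup>2) \<le> L\<^sup>2 * (\<Sum>j\<in>S. (x j)\<^sup>2)"
    and L: "0 < L"
  shows "ip x (R x) \<le> L * ip x x"
proof (rule ccontr)
  assume neg: "\<not> ?thesis"
  define t where "t = ip x (R x) / ip x x"
  define m where "m k = ip x ((R ^^ (2 ^ k)) x)" for k
  have nonneg: "0 \<le> ip y y" for y
    unfolding ip_def using D by (intro sum_nonneg) (auto simp: mult.assoc)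
  have CS: "(ip y z)\<^sup>2 \<le> ip y y * ip z z" for y z
  proof -
    have "ip y z = (\<Sum>j\<in>S. (sqrt (D j) * y j) * (sqrt (D j) * z j))"
      and "ip y y = (\<Sum>j\<in>S. (sqrt (D j) * y j)\<^sup>2)" and "ip z z = (\<Sum>j\<in>S. (sqrt (D j) * z j)\<^sup>2)"
      unfolding ip_def using D
      by (auto intro!: sum.cong simp: power_mult_distrib power2_eq_square mult_ac simp flip: real_sqrt_mult)
    then show ?thesis using Cauchy_Schwarz_ineq_sum by metis
  qed
  have powsym: "ip y ((R ^^ n) z) = ip ((R ^^ n) y) z" for n y z
  proof (induction n arbitrary: y z)
    case (Suc n)
    then show ?case using sym by (simp add: funpow_swap1)
  qed simp
  have le: "ip y y \<le> (\<Sum>j\<in>S. (y j)\<^sup>2)" for y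
    unfolding ip_def using D
    by (intro sum_mono) (auto simp: power2_eq_square mult.assoc intro: mult_left_le_one_le)
  \<comment> \<open>The form may be degenerate, but \<open>ip x x = 0\<close> would force
    \<open>ip x (R x) = 0\<close> by Cauchy--Schwarz, in agreement with the claim.\<close>
  have "0 < ip x x"
  proof (rule ccontr)
    assume "\<not> 0 < ip x x"
    with nonneg[of x] have "ip x x = 0" by simp
    then show False using CS[of x "R x"] neg by simp
  qed
  have tL: "L < t"
    using neg \<open>0 < ip x x\<close> by (simp add: t_def field_simps)
  \<comment> \<open>Symmetry moves half of the factors to the other side: \<open>m (Suc k)\<close>
    is the squared weighted norm of \<open>(R ^^ (2 ^ k)) x\<close>.\<close>
  have step: "(m k / ip x x)\<^sup>2 \<le> m (Suc k) / ip x x" for k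
  proof -
    have "(m k)\<^sup>2 \<le> ip x x * ip ((R ^^ (2 ^ k)) x) ((R ^^ (2 ^ k)) x)"
      unfolding m_def by (rule CS)
    also have "ip ((R ^^ (2 ^ k)) x) ((R ^^ (2 ^ k)) x) = m (Suc k)"
      unfolding powsym[symmetric] m_def mult_2 power_Suc funpow_add by simp
    finally show ?thesis
      using \<open>0 < ip x x\<close> by (simp add: power_divide power2_eq_square field_simps)
  qed
  have lower: "t ^ (2 ^ k) \<le> m k / ip x x" for k
  proof (induction k)
    case 0
    then show ?case by (simp add: t_def m_def)
  next
    case (Suc k)
    have "t ^ (2 ^ Suc k) = (t ^ (2 ^ k))\<^sup>2"
      by (simp add: mult.commute flip: power_mult)
    also have "\<dots> \<le> (m k / ip x x)\<^sup>2"
      using Suc tL L by (intro power_mono) auto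
    also have "\<dots> \<le> m (Suc k) / ip x x" by (rule step)
    finally show ?case .
  qed
  have pow: "(\<Sum>j\<in>S. ((R ^^ n) x j)\<^sup>2) \<le> (L ^ n)\<^sup>2 * (\<Sum>j\<in>S. (x j)\<^sup>2)" for n
  proof (induction n)
    case (Suc n)
    have "(\<Sum>j\<in>S. ((R ^^ Suc n) x j)\<^sup>2) \<le> L\<^sup>2 * (\<Sum>j\<in>S. ((R ^^ n) x j)\<^sup>2)"
      using bound by simp
    also have "\<dots> \<le> L\<^sup>2 * ((L ^ n)\<^sup>2 * (\<Sum>j\<in>S. (x j)\<^sup>2))"
      using Suc by (intro mult_left_mono) auto
    finally show ?case by (simp add: power_mult_distrib mult_ac)
  qed simp
  define C where "C = (\<Sum>j\<in>S. (x j)\<^sup>2) / ip x x"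
  \<comment> \<open>\<open>D \<le> 1\<close> bounds the weighted norm by the unweighted one, in
    which \<open>R\<close> has norm at most \<open>L\<close>. As \<open>C\<close> does not depend on
    \<open>k\<close>, this contradicts \<open>t / L > 1\<close>.\<close>
  have upper: "((t / L) ^ (2 ^ k))\<^sup>2 \<le> C" for k
  proof -
    have "(t ^ (2 ^ k))\<^sup>2 \<le> (m k / ip x x)\<^sup>2"
      using lower tL L by (intro power_mono) auto
    also have "\<dots> = (m k)\<^sup>2 / (ip x x)\<^sup>2" by (rule power_divide)
    also have "\<dots> \<le> ip x x * ((L ^ 2 ^ k)\<^sup>2 * (\<Sum>j\<in>S. (x j)\<^sup>2)) / (ip x x)\<^sup>2"
    proof (rule divide_right_mono)
      have "(m k)\<^sup>2 \<le> ip x x * ip ((R ^^ (2 ^ k)) x) ((R ^^ (2 ^ k)) x)"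
        unfolding m_def by (rule CS)
      also have "\<dots> \<le> ip x x * ((L ^ 2 ^ k)\<^sup>2 * (\<Sum>j\<in>S. (x j)\<^sup>2))"
        using le pow \<open>0 < ip x x\<close> by (intro mult_left_mono order_trans[OF le pow]) auto
      finally show "(m k)\<^sup>2 \<le> ip x x * ((L ^ 2 ^ k)\<^sup>2 * (\<Sum>j\<in>S. (x j)\<^sup>2))" .
    qed simp
    also have "\<dots> = (L ^ 2 ^ k)\<^sup>2 * C"
      using \<open>0 < ip x x\<close> by (simp add: C_def power2_eq_square)
    finally show ?thesis
      using L by (simp add: power_divide field_simps)
  qed
  have "1 < t / L" using tL L by simp
  then obtain n where "C + 1 < (t / L) ^ n"
    using real_arch_pow by blast
  also have "\<dots> \<le> (t / L) ^ (2 ^ n)"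
    using \<open>1 < t / L\<close> by (intro power_increasing) (auto intro: less_imp_le)
  finally have "C + 1 < (t / L) ^ (2 ^ n)" .
  moreover have "1 \<le> (t / L) ^ (2 ^ n)"
    using \<open>1 < t / L\<close> by (intro one_le_power) auto
  then have "(t / L) ^ (2 ^ n) \<le> ((t / L) ^ (2 ^ n))\<^sup>2"
    by (intro self_le_power) auto
  ultimately show False using upper[of n] by simp
qed

lemma sum_mult_swap:
  fixes V :: "'a \<Rightarrow> 'b \<Rightarrow> real"
  shows "(\<Sum>j\<in>J. y j * (\<Sum>i\<in>I. V i j * x i)) = (\<Sum>i\<in>I. x i * (\<Sum>j\<in>J. V i j * y j))"
  unfolding sum_distrib_left by (subst sum.swap) (simp add: mult_ac)

text \<open>For \<open>w = V\<^sup>T y\<close> one has \<open>\<parallel>w\<parallel>\<^sup>2 =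
  \<langle>y, V w\<rangle> \<le> \<parallel>y\<parallel> \<parallel>w\<parallel>\<close>, and a
  factor \<open>\<parallel>w\<parallel>\<close> cancels.\<close>

lemma contraction_transpose:
  fixes V :: "'a \<Rightarrow> 'b \<Rightarrow> real"
  assumes contr: "\<And>x. (\<Sum>i\<in>I. (\<Sum>j\<in>J. V i j * x j)\<^sup>2) \<le> (\<Sum>j\<in>J. (x j)\<^sup>2)"
  shows "(\<Sum>j\<in>J. (\<Sum>i\<in>I. V i j * y i)\<^sup>2) \<le> (\<Sum>i\<in>I. (y i)\<^sup>2)"
proof -
  define w where "w j = (\<Sum>i\<in>I. V i j * y i)" for j
  have "(\<Sum>j\<in>J. (w j)\<^sup>2) = (\<Sum>j\<in>J. w j * (\<Sum>i\<in>I. V i j * y i))"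
    by (simp add: w_def power2_eq_square)
  also have "\<dots> = (\<Sum>i\<in>I. y i * (\<Sum>j\<in>J. V i j * w j))"
    by (rule sum_mult_swap)
  finally have "(\<Sum>j\<in>J. (w j)\<^sup>2)\<^sup>2 = (\<Sum>i\<in>I. y i * (\<Sum>j\<in>J. V i j * w j))\<^sup>2"
    by simp
  also have "\<dots> \<le> (\<Sum>i\<in>I. (y i)\<^sup>2) * (\<Sum>i\<in>I. (\<Sum>j\<in>J. V i j * w j)\<^sup>2)"
    by (rule Cauchy_Schwarz_ineq_sum)
  also have "\<dots> \<le> (\<Sum>i\<in>I. (y i)\<^sup>2) * (\<Sum>j\<in>J. (w j)\<^sup>2)"
    by (intro mult_left_mono contr sum_nonneg) auto
  finally have "(\<Sum>j\<in>J. (w j)\<^sup>2) * (\<Sum>j\<in>J. (w j)\<^sup>2) \<le> (\<Sum>i\<in>I. (y i)\<^sup>2) * (\<Sum>j\<in>J. (w j)\<^sup>2)"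
    by (simp add: power2_eq_square)
  moreover have "0 \<le> (\<Sum>j\<in>J. (w j)\<^sup>2)" "0 \<le> (\<Sum>i\<in>I. (y i)\<^sup>2)"
    by (simp_all add: sum_nonneg)
  ultimately have "(\<Sum>j\<in>J. (w j)\<^sup>2) \<le> (\<Sum>i\<in>I. (y i)\<^sup>2)"
    by (cases "(\<Sum>j\<in>J. (w j)\<^sup>2) = 0") (simp_all add: mult_le_cancel_right)
  then show ?thesis by (simp add: w_def)
qed

text \<open>The operator \<open>R = V\<^sup>T a V b\<close> is symmetric for the inner product
  weighted by \<open>b\<close>, and \<open>\<parallel>R\<parallel> \<le> \<parallel>a V b\<parallel>
  \<le> L\<close> because \<open>V\<^sup>T\<close> is a contraction. So
  \<open>symmetrizable_operator_bound\<close> gives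
  \<open>\<langle>x, R x\<rangle> \<le> L \<langle>x, x\<rangle>\<close> in that product; at
  \<open>x = y / sqrt b\<close> this is the claim.\<close>

lemma weighted_contraction_sqrt:
  fixes V :: "'a \<Rightarrow> 'b \<Rightarrow> real"
  assumes contr: "\<And>x. (\<Sum>i\<in>I. (\<Sum>j\<in>J. V i j * x j)\<^sup>2) \<le> (\<Sum>j\<in>J. (x j)\<^sup>2)"
    and a: "\<And>i. i \<in> I \<Longrightarrow> 0 \<le> a i"
    and b: "\<And>j. j \<in> J \<Longrightarrow> 0 < b j" "\<And>j. j \<in> J \<Longrightarrow> b j \<le> 1"
    and bound: "\<And>x. (\<Sum>i\<in>I. (a i * (\<Sum>j\<in>J. V i j * (b j * x j)))\<^sup>2) \<le> L\<^sup>2 * (\<Sum>j\<in>J. (x j)\<^sup>2)"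
    and L: "0 < L"
  shows "(\<Sum>i\<in>I. (sqrt (a i) * (\<Sum>j\<in>J. V i j * (sqrt (b j) * y j)))\<^sup>2) \<le> L * (\<Sum>j\<in>J. (y j)\<^sup>2)"
proof -
  define R where "R x j = (\<Sum>i\<in>I. V i j * (a i * (\<Sum>k\<in>J. V i k * (b k * x k))))" for x j
  have R: "(\<Sum>j\<in>J. b j * x j * R y j) =
      (\<Sum>i\<in>I. a i * (\<Sum>k\<in>J. V i k * (b k * y k)) * (\<Sum>j\<in>J. V i j * (b j * x j)))" for x y
    unfolding R_def by (rule sum_mult_swap)
  have main: "(\<Sum>j\<in>J. b j * x j * R x j) \<le> L * (\<Sum>j\<in>J. b j * x j * x j)" for x
  proof (rule symmetrizable_operator_bound[OF _ _ _ _ L])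
    show "(\<Sum>j\<in>J. b j * x j * R y j) = (\<Sum>j\<in>J. b j * R x j * y j)" for x y
      using R[of x y] R[of y x] by (simp add: mult_ac)
    fix x
    have "(\<Sum>j\<in>J. (R x j)\<^sup>2) \<le> (\<Sum>i\<in>I. (a i * (\<Sum>k\<in>J. V i k * (b k * x k)))\<^sup>2)"
      unfolding R_def by (rule contraction_transpose[OF contr])
    also note bound
    finally show "(\<Sum>j\<in>J. (R x j)\<^sup>2) \<le> L\<^sup>2 * (\<Sum>j\<in>J. (x j)\<^sup>2)" .
  qed (use b in \<open>auto intro: less_imp_le\<close>)
  define x where "x j = y j / sqrt (b j)" for j
  have x: "b j * x j = sqrt (b j) * y j" "b j * x j * x j = (y j)\<^sup>2" if "j \<in> J" for j
    using b(1)[OF that] real_sqrt_mult_self[of "b j"]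
    by (auto simp: x_def field_simps power2_eq_square)
  have "(\<Sum>i\<in>I. (sqrt (a i) * (\<Sum>j\<in>J. V i j * (sqrt (b j) * y j)))\<^sup>2) =
      (\<Sum>i\<in>I. a i * (\<Sum>k\<in>J. V i k * (b k * x k)) * (\<Sum>k\<in>J. V i k * (b k * x k)))"
    using a by (intro sum.cong) (simp_all add: x power_mult_distrib power2_eq_square)
  also have "\<dots> \<le> L * (\<Sum>j\<in>J. b j * x j * x j)"
    using main[of x] by (simp add: R)
  also have "(\<Sum>j\<in>J. b j * x j * x j) = (\<Sum>j\<in>J. (y j)\<^sup>2)"
    by (intro sum.cong refl x(2))
  finally show ?thesis .
qed

text \<open>At \<open>k = 0\<close> the Hilbert--Schmidt norm bounds the operator norm, by
  Cauchy--Schwarz in each row. Every further step halves the exponents and takes the root of the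
  bound.\<close>

lemma exp_weighted_contraction:
  fixes V :: "'a \<Rightarrow> 'b \<Rightarrow> real"
  assumes contr: "\<And>x. (\<Sum>i\<in>I. (\<Sum>j\<in>J. V i j * x j)\<^sup>2) \<le> (\<Sum>j\<in>J. (x j)\<^sup>2)"
    and \<beta>: "\<And>j. j \<in> J \<Longrightarrow> 0 \<le> \<beta> j"
    and HS: "(\<Sum>i\<in>I. \<Sum>j\<in>J. (exp (- \<alpha> i) * V i j * exp (- \<beta> j))\<^sup>2) \<le> M\<^sup>2"
    and M: "0 < M"
  shows "(\<Sum>i\<in>I. (exp (- (\<alpha> i / 2 ^ k)) * (\<Sum>j\<in>J. V i j * (exp (- (\<beta> j / 2 ^ k)) * x j)))\<^sup>2)
           \<le> (M powr (1 / 2 ^ k))\<^sup>2 * (\<Sum>j\<in>J. (x j)\<^sup>2)"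
proof (induction k arbitrary: x)
  case 0
  have "(\<Sum>i\<in>I. (exp (- \<alpha> i) * (\<Sum>j\<in>J. V i j * (exp (- \<beta> j) * x j)))\<^sup>2) =
      (\<Sum>i\<in>I. (\<Sum>j\<in>J. (exp (- \<alpha> i) * V i j * exp (- \<beta> j)) * x j)\<^sup>2)"
    by (simp add: sum_distrib_left mult.assoc)
  also have "\<dots> \<le> (\<Sum>i\<in>I. (\<Sum>j\<in>J. (exp (- \<alpha> i) * V i j * exp (- \<beta> j))\<^sup>2) * (\<Sum>j\<in>J. (x j)\<^sup>2))"
    by (intro sum_mono Cauchy_Schwarz_ineq_sum)
  also have "\<dots> \<le> M\<^sup>2 * (\<Sum>j\<in>J. (x j)\<^sup>2)"
    unfolding sum_distrib_right[symmetric] by (intro mult_right_mono HS sum_nonneg) auto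
  finally show ?case using M by simp
next
  case (Suc k)
  have half: "sqrt (exp (- (t / 2 ^ k))) = exp (- (t / 2 ^ Suc k))" for t :: real
    by (rule real_sqrt_unique) (simp_all add: field_simps flip: exp_of_nat_mult exp_double)
  have "(M powr (1 / 2 ^ Suc k))\<^sup>2 = M powr (1 / 2 ^ k)"
    using M by (simp add: power2_eq_square flip: powr_add)
  moreover have "(\<Sum>i\<in>I. (sqrt (exp (- (\<alpha> i / 2 ^ k))) * (\<Sum>j\<in>J. V i j * (sqrt (exp (- (\<beta> j / 2 ^ k))) * x j)))\<^sup>2)
      \<le> M powr (1 / 2 ^ k) * (\<Sum>j\<in>J. (x j)\<^sup>2)"
    by (rule weighted_contraction_sqrt[OF contr _ _ _ Suc.IH]) (use \<beta> M in auto)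
  ultimately show ?case by (simp only: half)
qed

section \<open>The uncertainty inequality\<close>

text \<open>With \<open>t = \<alpha> n / 2 ^ k\<close>, the estimate
  \<open>(1 - exp (- t))\<^sup>2 \<le> t\<close> gives the majorant \<open>\<alpha> n * g n\<close>,
  and \<open>(1 - exp (- t))\<^sup>2 \<le> t\<^sup>2\<close> gives the pointwise limit. Dominated
  convergence joins the two, since \<open>(\<alpha> n)\<^sup>2 * g n\<close> may fail to be
  summable.\<close>

lemma exp_defect_tendsto_0:
  fixes \<alpha> g :: "'a \<Rightarrow> real"
  assumes \<alpha>: "\<And>n. 0 \<le> \<alpha> n" and g: "\<And>n. 0 \<le> g n"
    and sm: "(\<lambda>n. \<alpha> n * g n) summable_on UNIV"
  shows "(\<lambda>k. 2 ^ k * (\<Sum>\<^sub>\<infinity>n. (1 - exp (- (\<alpha> n / 2 ^ k)))\<^sup>2 * g n)) \<longlonglongrightarrow> 0"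
proof -
  define F where "F k n = 2 ^ k * ((1 - exp (- (\<alpha> n / 2 ^ k)))\<^sup>2 * g n)" for k n
  have defect: "0 \<le> 1 - exp (- t)" "1 - exp (- t) \<le> t" "1 - exp (- t) \<le> 1" if "0 \<le> t" for t :: real
    using that exp_ge_add_one_self[of "- t"] by auto
  have F0: "0 \<le> F k n" for k n
    using g by (simp add: F_def)
  have F1: "F k n \<le> \<alpha> n * g n" for k n
  proof -
    define t where "t = \<alpha> n / 2 ^ k"
    have "0 \<le> t" using \<alpha> by (simp add: t_def)
    then have "(1 - exp (- t)) * (1 - exp (- t)) \<le> t * 1"
      using defect[of t] by (intro mult_mono) auto
    then have "2 ^ k * ((1 - exp (- t))\<^sup>2 * g n) \<le> 2 ^ k * (t * g n)"
      using g by (intro mult_left_mono mult_right_mono) (auto simp: power2_eq_square)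
    then show ?thesis by (simp add: F_def t_def)
  qed
  have F2: "F k n \<le> (\<alpha> n)\<^sup>2 * g n * (1 / 2) ^ k" for k n
  proof -
    define t where "t = \<alpha> n / 2 ^ k"
    have "0 \<le> t" using \<alpha> by (simp add: t_def)
    then have "(1 - exp (- t))\<^sup>2 \<le> t\<^sup>2"
      using defect[of t] by (intro power_mono) auto
    then have "2 ^ k * ((1 - exp (- t))\<^sup>2 * g n) \<le> 2 ^ k * (t\<^sup>2 * g n)"
      using g by (intro mult_left_mono mult_right_mono) auto
    then show ?thesis by (simp add: F_def t_def power2_eq_square power_one_over field_simps)
  qed
  have lim: "(\<lambda>k. F k n) \<longlonglongrightarrow> 0" for n
  proof (rule tendsto_sandwich[OF _ _ tendsto_const])
    show "(\<lambda>k. (\<alpha> n)\<^sup>2 * g n * (1 / 2) ^ k) \<longlonglongrightarrow> 0"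
      by (intro tendsto_mult_right_zero LIMSEQ_realpow_zero) auto
  qed (use F0 F2 in auto)
  have smF: "F k summable_on UNIV" for k
    by (rule summable_on_bound[OF sm]) (use F0 F1 in \<open>simp add: abs_of_nonneg\<close>)
  \<comment> \<open>Reading the sums as integrals for counting measure makes dominated convergence
    available.\<close>
  have int: "integrable (count_space UNIV) f" "integral\<^sup>L (count_space UNIV) f = infsum f UNIV"
    if "f summable_on UNIV" for f :: "'a \<Rightarrow> real"
  proof -
    have "Infinite_Set_Sum.abs_summable_on f UNIV"
      using that summable_on_iff_abs_summable_on_real abs_summable_equivalent by blast
    then show "integrable (count_space UNIV) f" "integral\<^sup>L (count_space UNIV) f = infsum f UNIV"
      using infsetsum_infsum[of f UNIV]
      by (simp_all add: Infinite_Set_Sum.abs_summable_on_def infsetsum_def)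
  qed
  have "(\<lambda>k. integral\<^sup>L (count_space UNIV) (F k)) \<longlonglongrightarrow> integral\<^sup>L (count_space UNIV) (\<lambda>_ :: 'a. 0 :: real)"
    by (rule integral_dominated_convergence[where w = "\<lambda>n. \<alpha> n * g n"])
       (use lim F0 F1 int(1)[OF sm] in \<open>auto simp: abs_of_nonneg\<close>)
  then have "(\<lambda>k. infsum (F k) UNIV) \<longlonglongrightarrow> 0"
    by (simp add: int(2)[OF smF])
  then show ?thesis
    by (simp add: F_def[abs_def] infsum_cmult_right')
qed

text \<open>Extend \<open>x\<close> by zero: the full transform preserves its norm, and restricting
  the output to \<open>I\<close> can only lower it.\<close>

lemma finite_contraction_of_autocorrelation:
  fixes u x :: "int \<Rightarrow> real"
  assumes u: "u summable_on UNIV"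
    and ac: "\<And>k. (\<Sum>\<^sub>\<infinity>n. u n * u (n + k)) = (if k = 0 then 1 else 0)"
    and fin: "finite I" "finite J"
  shows "(\<Sum>i\<in>I. (\<Sum>j\<in>J. u (i + j) * x j)\<^sup>2) \<le> (\<Sum>j\<in>J. (x j)\<^sup>2)"
proof -
  define y where "y j = (if j \<in> J then x j else 0)" for j
  have "((\<lambda>j. (y j)\<^sup>2) has_sum (\<Sum>j\<in>J. (x j)\<^sup>2)) UNIV"
    by (rule has_sum_finite_neutralI[OF fin(2)]) (auto simp: y_def)
  then have y: "(\<lambda>j. (y j)\<^sup>2) summable_on UNIV" "(\<Sum>\<^sub>\<infinity>j. (y j)\<^sup>2) = (\<Sum>j\<in>J. (x j)\<^sup>2)"
    by (auto simp: has_sum_iff)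
  have "(\<Sum>\<^sub>\<infinity>j. u (i + j) * y j) = (\<Sum>j\<in>J. u (i + j) * x j)" for i
    by (rule infsumI, rule has_sum_finite_neutralI[OF fin(2)]) (auto simp: y_def)
  then have "((\<lambda>i. (\<Sum>j\<in>J. u (i + j) * x j)\<^sup>2) has_sum (\<Sum>j\<in>J. (x j)\<^sup>2)) UNIV"
    using isometry_of_autocorrelation(2)[OF u ac y(1)] by (simp add: y)
  then show ?thesis
    by (rule finite_sum_le_has_sum[OF _ fin(1)]) auto
qed

text \<open>The bound for finite sections is uniform, so \<open>J\<close> may exhaust the integers
  for a fixed finite \<open>I\<close>, and then \<open>I\<close> as well.\<close>

lemma exp_weighted_isometry_bound:
  fixes u \<phi> \<alpha> \<beta> :: "int \<Rightarrow> real"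
  assumes u: "u summable_on UNIV"
    and ac: "\<And>k. (\<Sum>\<^sub>\<infinity>n. u n * u (n + k)) = (if k = 0 then 1 else 0)"
    and \<beta>: "\<And>n. 0 \<le> \<beta> n"
    and M: "0 < M"
    and HS: "\<And>I J. finite I \<Longrightarrow> finite J \<Longrightarrow>
               (\<Sum>i\<in>I. \<Sum>j\<in>J. (exp (- \<alpha> i) * u (i + j) * exp (- \<beta> j))\<^sup>2) \<le> M\<^sup>2"
    and \<phi>: "(\<lambda>n. (\<phi> n)\<^sup>2) summable_on UNIV"
  defines "\<xi> \<equiv> \<lambda>k n. exp (- (\<alpha> n / 2 ^ k)) * (\<Sum>\<^sub>\<infinity>m. u (n + m) * (exp (- (\<beta> m / 2 ^ k)) * \<phi> m))"
  shows "(\<lambda>n. (\<xi> k n)\<^sup>2) summable_on UNIV"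
    and "(\<Sum>\<^sub>\<infinity>n. (\<xi> k n)\<^sup>2) \<le> (M powr (1 / 2 ^ k))\<^sup>2 * (\<Sum>\<^sub>\<infinity>n. (\<phi> n)\<^sup>2)"
proof -
  let ?b = "\<lambda>m. exp (- (\<beta> m / 2 ^ k))"
  have b\<phi>: "(\<lambda>n. (?b n * \<phi> n)\<^sup>2) summable_on UNIV"
  proof (rule summable_on_bound[OF \<phi>])
    show "\<bar>(?b n * \<phi> n)\<^sup>2\<bar> \<le> (\<phi> n)\<^sup>2" for n
      using \<beta>[of n] by (simp add: power_mult_distrib mult_left_le_one_le power_le_one)
  qed
  have le: "(\<Sum>i\<in>I. (\<xi> k i)\<^sup>2) \<le> (M powr (1 / 2 ^ k))\<^sup>2 * (\<Sum>\<^sub>\<infinity>n. (\<phi> n)\<^sup>2)" if I: "finite I" for I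
  proof (rule tendsto_upperbound)
    have "((\<lambda>J. \<Sum>m\<in>J. u (n + m) * (?b m * \<phi> m)) \<longlongrightarrow> (\<Sum>\<^sub>\<infinity>m. u (n + m) * (?b m * \<phi> m)))
            (finite_subsets_at_top UNIV)" for n
      by (intro infsum_tendsto isometry_of_autocorrelation(1)[OF u ac b\<phi>])
    then show "((\<lambda>J. \<Sum>i\<in>I. (exp (- (\<alpha> i / 2 ^ k)) * (\<Sum>m\<in>J. u (i + m) * (?b m * \<phi> m)))\<^sup>2)
            \<longlongrightarrow> (\<Sum>i\<in>I. (\<xi> k i)\<^sup>2)) (finite_subsets_at_top UNIV)"
      unfolding \<xi>_def by (intro tendsto_sum tendsto_power tendsto_mult tendsto_const)
    show "\<forall>\<^sub>F J in finite_subsets_at_top UNIV.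
        (\<Sum>i\<in>I. (exp (- (\<alpha> i / 2 ^ k)) * (\<Sum>m\<in>J. u (i + m) * (?b m * \<phi> m)))\<^sup>2)
          \<le> (M powr (1 / 2 ^ k))\<^sup>2 * (\<Sum>\<^sub>\<infinity>n. (\<phi> n)\<^sup>2)"
    proof (rule eventually_finite_subsets_at_top_weakI)
      fix J :: "int set" assume J: "finite J"
      have "(\<Sum>i\<in>I. (exp (- (\<alpha> i / 2 ^ k)) * (\<Sum>m\<in>J. u (i + m) * (?b m * \<phi> m)))\<^sup>2)
          \<le> (M powr (1 / 2 ^ k))\<^sup>2 * (\<Sum>m\<in>J. (\<phi> m)\<^sup>2)"
        by (rule exp_weighted_contraction[OF finite_contraction_of_autocorrelation[OF u ac I J] \<beta> HS[OF I J] M])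
      also have "\<dots> \<le> (M powr (1 / 2 ^ k))\<^sup>2 * (\<Sum>\<^sub>\<infinity>n. (\<phi> n)\<^sup>2)"
        using J by (intro mult_left_mono finite_sum_le_infsum \<phi>) auto
      finally show "(\<Sum>i\<in>I. (exp (- (\<alpha> i / 2 ^ k)) * (\<Sum>m\<in>J. u (i + m) * (?b m * \<phi> m)))\<^sup>2)
          \<le> (M powr (1 / 2 ^ k))\<^sup>2 * (\<Sum>\<^sub>\<infinity>n. (\<phi> n)\<^sup>2)" .
    qed
  qed simp
  show sm: "(\<lambda>n. (\<xi> k n)\<^sup>2) summable_on UNIV"
    by (rule nonneg_bdd_above_summable_on) (use le in \<open>auto intro!: bdd_aboveI2\<close>)
  show "(\<Sum>\<^sub>\<infinity>n. (\<xi> k n)\<^sup>2) \<le> (M powr (1 / 2 ^ k))\<^sup>2 * (\<Sum>\<^sub>\<infinity>n. (\<phi> n)\<^sup>2)"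
    by (rule infsum_le_finite_sums[OF sm]) (use le in auto)
qed

text \<open>
  Golden--Thompson in disguise: the left-hand side bounds below the quadratic form of
  \<open>H = \<beta> + U\<^sup>* \<alpha> U\<close>, and \<open>M\<close> bounds the Hilbert--Schmidt norm of \<open>exp (-\<alpha>) U exp (-\<beta>)\<close>.
  The claim is the derivative at \<open>\<theta> = 0\<close> of
  \<open>\<langle>\<psi>, exp (-\<theta> \<alpha>) U exp (-\<theta> \<beta>) \<phi>\<rangle> \<le> M\<^sup>\<theta> \<parallel>\<psi>\<parallel> \<parallel>\<phi>\<parallel>\<close>, taken along \<open>\<theta> = 1 / 2\<^sup>k\<close>.
\<close>

theorem uncertainty_of_autocorrelation:
  fixes u \<phi> \<alpha> \<beta> :: "int \<Rightarrow> real"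
  assumes u: "u summable_on UNIV"
    and ac: "\<And>k. (\<Sum>\<^sub>\<infinity>n. u n * u (n + k)) = (if k = 0 then 1 else 0)"
    and \<alpha>: "\<And>n. 0 \<le> \<alpha> n" and \<beta>: "\<And>n. 0 \<le> \<beta> n"
    and M: "0 < M"
    and HS: "\<And>I J. finite I \<Longrightarrow> finite J \<Longrightarrow>
               (\<Sum>i\<in>I. \<Sum>j\<in>J. (exp (- \<alpha> i) * u (i + j) * exp (- \<beta> j))\<^sup>2) \<le> M\<^sup>2"
    and \<phi>: "(\<lambda>n. (\<phi> n)\<^sup>2) summable_on UNIV"
    and \<beta>\<phi>: "(\<lambda>n. \<beta> n * (\<phi> n)\<^sup>2) summable_on UNIV"
  defines "\<psi> \<equiv> \<lambda>n. \<Sum>\<^sub>\<infinity>m. u (n + m) * \<phi> m"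
  assumes \<alpha>\<psi>: "(\<lambda>n. \<alpha> n * (\<psi> n)\<^sup>2) summable_on UNIV"
  shows "- ln M * (\<Sum>\<^sub>\<infinity>n. (\<phi> n)\<^sup>2) \<le> (\<Sum>\<^sub>\<infinity>n. \<beta> n * (\<phi> n)\<^sup>2) + (\<Sum>\<^sub>\<infinity>n. \<alpha> n * (\<psi> n)\<^sup>2)"
proof -
  define N where "N = (\<Sum>\<^sub>\<infinity>n. (\<phi> n)\<^sup>2)"
  define E where "E = (\<Sum>\<^sub>\<infinity>n. \<beta> n * (\<phi> n)\<^sup>2) + (\<Sum>\<^sub>\<infinity>n. \<alpha> n * (\<psi> n)\<^sup>2)"
  define a where "a k n = exp (- (\<alpha> n / 2 ^ k))" for k :: nat and n
  define b where "b k n = exp (- (\<beta> n / 2 ^ k))" for k :: nat and n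
  define m where "m k = M powr (1 / 2 ^ k)" for k :: nat
  \<comment> \<open>\<open>P\<close> and \<open>Q\<close> are the squared distances of
    \<open>\<psi>\<close> and \<open>\<phi>\<close> from their damped versions. Even multiplied by
    \<open>2 ^ k\<close> they vanish in the limit.\<close>
  define P where "P k = (\<Sum>\<^sub>\<infinity>n. (1 - a k n)\<^sup>2 * (\<psi> n)\<^sup>2)" for k
  define Q where "Q k = (\<Sum>\<^sub>\<infinity>n. (1 - b k n)\<^sup>2 * (\<phi> n)\<^sup>2)" for k
  have iso: "(\<lambda>m. u (n + m) * x m) summable_on UNIV"
      "((\<lambda>n. (\<Sum>\<^sub>\<infinity>m. u (n + m) * x m)\<^sup>2) has_sum (\<Sum>\<^sub>\<infinity>n. (x n)\<^sup>2)) UNIV"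
    if "(\<lambda>n. (x n)\<^sup>2) summable_on UNIV" for x n
    using isometry_of_autocorrelation[OF u ac that] by auto
  have \<psi>: "((\<lambda>n. (\<psi> n)\<^sup>2) has_sum N) UNIV"
    using iso(2)[OF \<phi>] by (simp add: \<psi>_def N_def)
  have a: "0 < a k n" "a k n \<le> 1" and b: "0 < b k n" "b k n \<le> 1" for k n
    using \<alpha> \<beta> by (auto simp: a_def b_def)
  have sq: "1 - 2 * (t / 2 ^ k) \<le> (exp (- (t / 2 ^ k)))\<^sup>2" for t :: real and k :: nat
    using exp_ge_add_one_self[of "- 2 * (t / 2 ^ k)"] by (simp flip: exp_of_nat_mult exp_double)
  have m: "0 < m k" for k using M by (simp add: m_def)
  have sqle: "\<bar>c\<^sup>2 * y\<^sup>2\<bar> \<le> y\<^sup>2" if "0 \<le> c" "c \<le> 1" for c y :: real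
    using that by (simp add: mult_left_le_one_le power_le_one)
  \<comment> \<open>The bound at \<open>\<theta> = 1 / 2 ^ k\<close>, divided by
    \<open>\<theta>\<close>; the factor \<open>m k\<close> tends to 1 as \<open>k\<close>
    grows.\<close>
  have key: "N * (m k * - ln M) \<le> E + 2 ^ k * P k + 2 ^ k * Q k" for k
  proof -
    define h where "h n = (\<Sum>\<^sub>\<infinity>m. u (n + m) * (b k m * \<phi> m))" for n
    define \<theta> :: real where "\<theta> = 1 / 2 ^ k"
    have s1: "(\<lambda>n. (b k n)\<^sup>2 * (\<phi> n)\<^sup>2) summable_on UNIV"
      by (rule summable_on_bound[OF \<phi>]) (rule sqle, use less_imp_le[OF b(1)] b(2) in auto)
    have s2: "(\<lambda>n. (1 - b k n)\<^sup>2 * (\<phi> n)\<^sup>2) summable_on UNIV"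
      by (rule summable_on_bound[OF \<phi>]) (rule sqle, use less_imp_le[OF b(1)] b(2) in auto)
    have s3: "(\<lambda>n. (1 - a k n)\<^sup>2 * (\<psi> n)\<^sup>2) summable_on UNIV"
      by (rule summable_on_bound[OF has_sum_imp_summable[OF \<psi>]])
         (rule sqle, use less_imp_le[OF a(1)] a(2) in auto)
    have b\<phi>: "(\<lambda>n. (b k n * \<phi> n)\<^sup>2) summable_on UNIV" "(\<lambda>n. ((1 - b k n) * \<phi> n)\<^sup>2) summable_on UNIV"
      using s1 s2 by (simp_all add: power_mult_distrib)
    have h: "((\<lambda>n. (h n)\<^sup>2) has_sum (\<Sum>\<^sub>\<infinity>n. (b k n)\<^sup>2 * (\<phi> n)\<^sup>2)) UNIV"
      using iso(2)[OF b\<phi>(1)] by (simp add: h_def power_mult_distrib)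
    \<comment> \<open>By linearity \<open>\<psi> - h\<close> is the transform of
      \<open>(1 - b) \<phi>\<close>, so the isometry gives it the squared norm
      \<open>Q k\<close>.\<close>
    have "\<psi> n - h n = (\<Sum>\<^sub>\<infinity>m. u (n + m) * ((1 - b k m) * \<phi> m))" for n
    proof -
      have "((\<lambda>m. u (n + m) * \<phi> m - u (n + m) * (b k m * \<phi> m)) has_sum (\<psi> n - h n)) UNIV"
        using iso(1)[OF \<phi>] iso(1)[OF b\<phi>(1)] by (intro has_sum_diff) (simp_all add: \<psi>_def h_def)
      then show ?thesis by (intro infsumI[symmetric]) (simp add: algebra_simps)
    qed
    then have \<psi>h: "((\<lambda>n. (\<psi> n - h n)\<^sup>2) has_sum Q k) UNIV"
      using iso(2)[OF b\<phi>(2)] by (simp add: Q_def power_mult_distrib)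
    define X where "X = (\<Sum>\<^sub>\<infinity>n. (a k n * h n)\<^sup>2)"
    have sX: "(\<lambda>n. (a k n * h n)\<^sup>2) summable_on UNIV" and X: "X \<le> (m k)\<^sup>2 * N"
      using exp_weighted_isometry_bound[OF u ac \<beta> M HS \<phi>, of k]
      by (simp_all add: X_def a_def b_def h_def m_def N_def)
    \<comment> \<open>Start from \<open>(a \<psi>)\<^sup>2 + h\<^sup>2 = (a \<psi> - h)\<^sup>2 + 2
      \<psi> (a h)\<close>. The difference is \<open>(\<psi> - h) - (1 - a) \<psi>\<close>, made of
      two small defects. The product is split with weight \<open>m k\<close>, which balances its two
      parts because \<open>\<parallel>a h\<parallel>\<^sup>2 \<le> (m k)\<^sup>2 N\<close>.\<close>
    have pointwise: "(1 - 2 * \<theta> * \<alpha> n) * (\<psi> n)\<^sup>2 + (h n)\<^sup>2 - 2 * ((1 - a k n)\<^sup>2 * (\<psi> n)\<^sup>2) - 2 * (\<psi> n - h n)\<^sup>2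
        \<le> m k * (\<psi> n)\<^sup>2 + (a k n * h n)\<^sup>2 / m k" for n
    proof -
      have "(1 - 2 * \<theta> * \<alpha> n) * (\<psi> n)\<^sup>2 \<le> (a k n * \<psi> n)\<^sup>2"
        using sq[of "\<alpha> n" k] by (auto simp: a_def \<theta>_def power_mult_distrib intro!: mult_right_mono)
      moreover have "(a k n * \<psi> n - h n)\<^sup>2 \<le> 2 * ((1 - a k n)\<^sup>2 * (\<psi> n)\<^sup>2) + 2 * (\<psi> n - h n)\<^sup>2"
        using zero_le_power2[of "(\<psi> n - h n) + (1 - a k n) * \<psi> n"]
        by (simp add: power2_eq_square algebra_simps)
      moreover have "2 * \<psi> n * (a k n * h n) \<le> m k * (\<psi> n)\<^sup>2 + (a k n * h n)\<^sup>2 / m k"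
        using zero_le_power2[of "m k * \<psi> n - a k n * h n"] m[of k]
        by (simp add: field_simps power2_eq_square)
      ultimately show ?thesis
        by (simp add: power2_eq_square algebra_simps)
    qed
    have "((\<lambda>n. (\<psi> n)\<^sup>2 - 2 * \<theta> * (\<alpha> n * (\<psi> n)\<^sup>2) + (h n)\<^sup>2 - 2 * ((1 - a k n)\<^sup>2 * (\<psi> n)\<^sup>2) - 2 * (\<psi> n - h n)\<^sup>2) has_sum
        (N - 2 * \<theta> * (\<Sum>\<^sub>\<infinity>n. \<alpha> n * (\<psi> n)\<^sup>2) + (\<Sum>\<^sub>\<infinity>n. (b k n)\<^sup>2 * (\<phi> n)\<^sup>2) - 2 * P k - 2 * Q k)) UNIV"
      using \<alpha>\<psi> s3 unfolding P_def
      by (intro has_sum_diff has_sum_add has_sum_cmult_right h \<psi> \<psi>h has_sum_infsum)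
    moreover have "((\<lambda>n. m k * (\<psi> n)\<^sup>2 + (a k n * h n)\<^sup>2 * (1 / m k)) has_sum (m k * N + X * (1 / m k))) UNIV"
      using sX unfolding X_def
      by (intro has_sum_add has_sum_cmult_right has_sum_cmult_left \<psi> has_sum_infsum)
    ultimately have "N - 2 * \<theta> * (\<Sum>\<^sub>\<infinity>n. \<alpha> n * (\<psi> n)\<^sup>2) + (\<Sum>\<^sub>\<infinity>n. (b k n)\<^sup>2 * (\<phi> n)\<^sup>2) - 2 * P k - 2 * Q k
        \<le> m k * N + X * (1 / m k)"
      by (rule has_sum_mono) (use pointwise in \<open>simp add: algebra_simps\<close>)
    moreover have "X * (1 / m k) \<le> m k * N"
      using X m[of k] by (simp add: field_simps power2_eq_square)
    moreover have "N - 2 * \<theta> * (\<Sum>\<^sub>\<infinity>n. \<beta> n * (\<phi> n)\<^sup>2) \<le> (\<Sum>\<^sub>\<infinity>n. (b k n)\<^sup>2 * (\<phi> n)\<^sup>2)"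
    proof (rule has_sum_mono)
      show "((\<lambda>n. (\<phi> n)\<^sup>2 - 2 * \<theta> * (\<beta> n * (\<phi> n)\<^sup>2)) has_sum (N - 2 * \<theta> * (\<Sum>\<^sub>\<infinity>n. \<beta> n * (\<phi> n)\<^sup>2))) UNIV"
        using \<phi> \<beta>\<phi> unfolding N_def by (intro has_sum_diff has_sum_cmult_right has_sum_infsum)
      show "((\<lambda>n. (b k n)\<^sup>2 * (\<phi> n)\<^sup>2) has_sum (\<Sum>\<^sub>\<infinity>n. (b k n)\<^sup>2 * (\<phi> n)\<^sup>2)) UNIV"
        using s1 by (rule has_sum_infsum)
      fix n
      have "(1 - 2 * \<theta> * \<beta> n) * (\<phi> n)\<^sup>2 \<le> (b k n)\<^sup>2 * (\<phi> n)\<^sup>2"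
        using sq[of "\<beta> n" k] by (intro mult_right_mono) (auto simp: b_def \<theta>_def)
      then show "(\<phi> n)\<^sup>2 - 2 * \<theta> * (\<beta> n * (\<phi> n)\<^sup>2) \<le> (b k n)\<^sup>2 * (\<phi> n)\<^sup>2"
        by (simp add: algebra_simps)
    qed
    ultimately have "N * (1 - m k) \<le> \<theta> * E + P k + Q k"
      by (simp add: E_def algebra_simps)
    then have "2 ^ k * (N * (1 - m k)) \<le> 2 ^ k * (\<theta> * E + P k + Q k)"
      by (rule mult_left_mono) simp
    then have *: "N * (2 ^ k * (1 - m k)) \<le> E + 2 ^ k * P k + 2 ^ k * Q k"
      by (simp add: \<theta>_def algebra_simps)
    \<comment> \<open>Applying the tangent bound to \<open>1 / m k\<close> rather than to
      \<open>m k\<close> gives a lower bound for \<open>1 - m k\<close>.\<close>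
    have "1 + - (ln M / 2 ^ k) \<le> exp (- (ln M / 2 ^ k))"
      by (rule exp_ge_add_one_self)
    also have "\<dots> = 1 / m k"
      using M by (simp add: m_def powr_def exp_minus field_simps)
    finally have "m k * - ln M \<le> 2 ^ k * (1 - m k)"
      using m[of k] by (simp add: field_simps)
    moreover have "0 \<le> N"
      unfolding N_def by (intro infsum_nonneg) simp
    ultimately have "N * (m k * - ln M) \<le> N * (2 ^ k * (1 - m k))"
      by (intro mult_left_mono)
    with * show ?thesis by linarith
  qed
  have "(\<lambda>k. 2 ^ k * P k) \<longlonglongrightarrow> 0" "(\<lambda>k. 2 ^ k * Q k) \<longlonglongrightarrow> 0"
    unfolding P_def Q_def a_def b_def
    using exp_defect_tendsto_0[OF \<alpha> _ \<alpha>\<psi>] exp_defect_tendsto_0[OF \<beta> _ \<beta>\<phi>] by auto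
  then have "(\<lambda>k. E + 2 ^ k * P k + 2 ^ k * Q k) \<longlonglongrightarrow> E + 0 + 0"
    by (intro tendsto_intros)
  then have limE: "(\<lambda>k. E + 2 ^ k * P k + 2 ^ k * Q k) \<longlonglongrightarrow> E" by simp
  have "(\<lambda>k. 1 / 2 ^ k :: real) \<longlonglongrightarrow> 0"
    using LIMSEQ_realpow_zero[of "1/2 :: real"] by (simp add: power_one_over)
  then have "m \<longlonglongrightarrow> M powr 0"
    unfolding m_def using M by (intro tendsto_powr tendsto_const) auto
  then have "(\<lambda>k. N * (m k * - ln M)) \<longlonglongrightarrow> N * (M powr 0 * - ln M)"
    by (intro tendsto_intros)
  from this limE have "N * (M powr 0 * - ln M) \<le> E"
    by (rule LIMSEQ_le) (use key in auto)
  then show ?thesis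
    using M by (simp add: N_def E_def mult.commute)
qed

text \<open>The kernel is real, so it acts separately on real and imaginary parts, and all three
  quadratic quantities are additive in them.\<close>

corollary complex_uncertainty_of_autocorrelation:
  fixes u \<alpha> \<beta> :: "int \<Rightarrow> real" and \<phi> :: "int \<Rightarrow> complex"
  assumes u: "u summable_on UNIV"
    and ac: "\<And>k. (\<Sum>\<^sub>\<infinity>n. u n * u (n + k)) = (if k = 0 then 1 else 0)"
    and \<alpha>: "\<And>n. 0 \<le> \<alpha> n" and \<beta>: "\<And>n. 0 \<le> \<beta> n"
    and M: "0 < M"
    and HS: "\<And>I J. finite I \<Longrightarrow> finite J \<Longrightarrow>
               (\<Sum>i\<in>I. \<Sum>j\<in>J. (exp (- \<alpha> i) * u (i + j) * exp (- \<beta> j))\<^sup>2) \<le> M\<^sup>2"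
    and \<phi>: "(\<lambda>n. (cmod (\<phi> n))\<^sup>2) summable_on UNIV"
    and \<beta>\<phi>: "(\<lambda>n. \<beta> n * (cmod (\<phi> n))\<^sup>2) summable_on UNIV"
  defines "\<psi> \<equiv> \<lambda>n. \<Sum>\<^sub>\<infinity>m. of_real (u (n + m)) * \<phi> m"
  assumes \<alpha>\<psi>: "(\<lambda>n. \<alpha> n * (cmod (\<psi> n))\<^sup>2) summable_on UNIV"
  shows "- ln M * (\<Sum>\<^sub>\<infinity>n. (cmod (\<phi> n))\<^sup>2)
           \<le> (\<Sum>\<^sub>\<infinity>n. \<beta> n * (cmod (\<phi> n))\<^sup>2) + (\<Sum>\<^sub>\<infinity>n. \<alpha> n * (cmod (\<psi> n))\<^sup>2)"
proof -
  obtain K where "\<And>n. \<bar>(cmod (\<phi> n))\<^sup>2\<bar> \<le> K" using summable_on_bounded[OF \<phi>] by blast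
  then have K: "cmod (\<phi> n) \<le> sqrt K" for n
    using real_sqrt_le_mono[of "(cmod (\<phi> n))\<^sup>2" K] by simp
  have "(\<lambda>m. of_real (u (n + m)) * \<phi> m) summable_on UNIV" for n
  proof (rule Infinite_Sum.abs_summable_summable, rule Infinite_Sum.abs_summable_on_comparison_test')
    show "(\<lambda>m. \<bar>u (n + m)\<bar> * sqrt K) summable_on UNIV"
      by (intro summable_on_cmult_left summable_on_abs) (simp add: summable_on_shift u)
    show "cmod (of_real (u (n + m)) * \<phi> m) \<le> \<bar>u (n + m)\<bar> * sqrt K" for m
      using K[of m] by (simp add: norm_mult mult_left_mono)
  qed
  then have Re\<psi>: "Re (\<psi> n) = (\<Sum>\<^sub>\<infinity>m. u (n + m) * Re (\<phi> m))"
    and Im\<psi>: "Im (\<psi> n) = (\<Sum>\<^sub>\<infinity>m. u (n + m) * Im (\<phi> m))" for n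
    unfolding \<psi>_def by (simp_all flip: infsum_Re infsum_Im)
  have part: "(\<lambda>n. w n * (Re (x n))\<^sup>2) summable_on UNIV" "(\<lambda>n. w n * (Im (x n))\<^sup>2) summable_on UNIV"
      "(\<Sum>\<^sub>\<infinity>n. w n * (cmod (x n))\<^sup>2) = (\<Sum>\<^sub>\<infinity>n. w n * (Re (x n))\<^sup>2) + (\<Sum>\<^sub>\<infinity>n. w n * (Im (x n))\<^sup>2)"
    if "(\<lambda>n. w n * (cmod (x n))\<^sup>2) summable_on UNIV" "\<And>n. 0 \<le> w n" for w and x :: "int \<Rightarrow> complex"
  proof -
    show 1: "(\<lambda>n. w n * (Re (x n))\<^sup>2) summable_on UNIV"
      by (rule summable_on_bound[OF that(1)]) (use that(2) in \<open>auto simp: abs_mult cmod_power2 intro!: mult_left_mono\<close>)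
    show 2: "(\<lambda>n. w n * (Im (x n))\<^sup>2) summable_on UNIV"
      by (rule summable_on_bound[OF that(1)]) (use that(2) in \<open>auto simp: abs_mult cmod_power2 intro!: mult_left_mono\<close>)
    show "(\<Sum>\<^sub>\<infinity>n. w n * (cmod (x n))\<^sup>2) = (\<Sum>\<^sub>\<infinity>n. w n * (Re (x n))\<^sup>2) + (\<Sum>\<^sub>\<infinity>n. w n * (Im (x n))\<^sup>2)"
      unfolding infsum_add[OF 1 2, symmetric] by (simp add: cmod_power2 distrib_left)
  qed
  note \<phi>' = part[of "\<lambda>_. 1" \<phi>, simplified, OF \<phi>]
    and \<beta>\<phi>' = part[of \<beta> \<phi>, OF \<beta>\<phi> \<beta>] and \<alpha>\<psi>' = part[of \<alpha> \<psi>, OF \<alpha>\<psi> \<alpha>]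
  have "- ln M * (\<Sum>\<^sub>\<infinity>n. (Re (\<phi> n))\<^sup>2)
      \<le> (\<Sum>\<^sub>\<infinity>n. \<beta> n * (Re (\<phi> n))\<^sup>2) + (\<Sum>\<^sub>\<infinity>n. \<alpha> n * (Re (\<psi> n))\<^sup>2)"
    using uncertainty_of_autocorrelation[OF u ac \<alpha> \<beta> M HS \<phi>'(1) \<beta>\<phi>'(1)] \<alpha>\<psi>'(1) by (simp add: Re\<psi>)
  moreover have "- ln M * (\<Sum>\<^sub>\<infinity>n. (Im (\<phi> n))\<^sup>2)
      \<le> (\<Sum>\<^sub>\<infinity>n. \<beta> n * (Im (\<phi> n))\<^sup>2) + (\<Sum>\<^sub>\<infinity>n. \<alpha> n * (Im (\<psi> n))\<^sup>2)"
    using uncertainty_of_autocorrelation[OF u ac \<alpha> \<beta> M HS \<phi>'(2) \<beta>\<phi>'(2)] \<alpha>\<psi>'(2) by (simp add: Im\<psi>)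
  ultimately show ?thesis
    by (simp only: \<phi>'(3) \<beta>\<phi>'(3) \<alpha>\<psi>'(3) distrib_left)
qed

section \<open>From Jackson integrals to sequences on the integers\<close>

lemma powi_powr:
  fixes q :: real
  assumes "0 < q"
  shows "(q powi n) powr t = (q powr t) powi n"
proof -
  have "q powi n = q powr real_of_int n"
    using assms by (simp add: powr_real_of_int')
  moreover have "(q powr t) powi n = (q powr t) powr real_of_int n"
    using assms by (simp add: powr_real_of_int')
  ultimately show ?thesis
    by (simp add: powr_powr mult.commute)
qed

lemma jackson_weight:
  fixes q v :: real
  assumes "0 < q"
  shows "q powi n * (q powi n) powr (2 * v + 1) = ((q powr (v + 1)) powi n)\<^sup>2"
proof -
  have "q powi n * (q powi n) powr (2 * v + 1) = (q powi n) powr (1 + (2 * v + 1))"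
    unfolding powr_add[of _ 1] using assms by simp
  also have "1 + (2 * v + 1) = (v + 1) + (v + 1)"
    by simp
  also have "(q powi n) powr \<dots> = (q powi n) powr (v + 1) * (q powi n) powr (v + 1)"
    by (rule powr_add)
  finally show ?thesis
    using assms by (simp add: powi_powr power2_eq_square)
qed

text \<open>Infinite values are included, so that the weighted norms can be rewritten before it is
  known whether they are finite.\<close>

lemma Lq_norm_2_power2:
  fixes q v :: real
  assumes q: "0 < q" "q < 1"
  shows "(Lq_norm q 2 v f)\<^sup>2 =
    ennreal (1 - q) * (\<Sum>\<^sub>\<infinity>n. ennreal ((cmod (of_real ((q powr (v + 1)) powi n) * f (q powi n)))\<^sup>2))"
proof -
  define I where "I = jackson_nn_integral q (\<lambda>x. ennreal (cmod (f x) powr 2 * x powr (2 * v + 1)))"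
  have "ennreal (q powi n) * ennreal (cmod (f (q powi n)) powr 2 * (q powi n) powr (2 * v + 1)) =
      ennreal ((cmod (of_real ((q powr (v + 1)) powi n) * f (q powi n)))\<^sup>2)" for n
  proof -
    have "q powi n * (cmod (f (q powi n)) powr 2 * (q powi n) powr (2 * v + 1)) =
        (cmod (of_real ((q powr (v + 1)) powi n) * f (q powi n)))\<^sup>2"
      unfolding norm_mult norm_of_real power_mult_distrib using jackson_weight[OF q(1), of n v]
      by (simp add: mult_ac)
    then show ?thesis using q by (simp flip: ennreal_mult)
  qed
  then have "I = ennreal (1 - q) * (\<Sum>\<^sub>\<infinity>n. ennreal ((cmod (of_real ((q powr (v + 1)) powi n) * f (q powi n)))\<^sup>2))"
    by (simp add: I_def jackson_nn_integral_def)
  moreover have L: "Lq_norm q 2 v f = (if I = \<infinity> then \<infinity> else ennreal (enn2real I powr (1 / 2)))"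
    by (simp only: Lq_norm_def I_def Let_def)
  have "(Lq_norm q 2 v f)\<^sup>2 = I"
  proof (cases "I = \<infinity>")
    case True
    then show ?thesis by (simp add: L)
  next
    case False
    have "(ennreal (enn2real I powr (1 / 2)))\<^sup>2 = ennreal (enn2real I)"
      by (simp add: ennreal_power powr_half_sqrt)
    also have "\<dots> = I" using False by (simp add: ennreal_enn2real_if)
    finally show ?thesis using False by (simp add: L)
  qed
  ultimately show ?thesis by simp
qed

text \<open>The Jackson weight \<open>(s powi m)\<^sup>2\<close> gives one root to the input and,
  together with \<open>s powi n\<close>, the other to the kernel. Constants pass through
  \<open>infsum\<close> in a field even where the sum diverges, so the identity holds for every
  \<open>f\<close>.\<close>

lemma qbessel_fourier_powi:
  fixes q v :: real
  assumes q: "0 < q" "q < 1"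
  defines "s \<equiv> q powr (v + 1)"
  shows "of_real (s powi n) * qbessel_fourier q v f (q powi n) =
    (\<Sum>\<^sub>\<infinity>m. of_real (bessel_kernel q v (n + m)) * (of_real (s powi m) * f (q powi m)))"
proof -
  have "of_real (s powi n) * qbessel_fourier q v f (q powi n) =
      (\<Sum>\<^sub>\<infinity>m. of_real (s powi n * c_const q v * (1 - q)) *
        ((q powi m) *\<^sub>R (f (q powi m) * of_real (qbessel_j q v (q powi n * q powi m)) *
           of_real ((q powi m) powr (2 * v + 1)))))"
    unfolding infsum_cmult_right' qbessel_fourier_def jackson_integral_def
    by (simp add: scaleR_conv_of_real mult_ac)
  also have "\<dots> = (\<Sum>\<^sub>\<infinity>m. of_real (bessel_kernel q v (n + m)) * (of_real (s powi m) * f (q powi m)))"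
  proof (rule infsum_cong)
    fix m
    have "s powi n * c_const q v * (1 - q) * (q powi m * (qbessel_j q v (q powi n * q powi m) * (q powi m) powr (2 * v + 1)))
        = s powi n * c_const q v * (1 - q) * qbessel_j q v (q powi (n + m)) * (q powi m * (q powi m) powr (2 * v + 1))"
      using q by (simp add: power_int_add mult_ac)
    also have "\<dots> = bessel_kernel q v (n + m) * s powi m"
      unfolding jackson_weight[OF q(1)] using q
      by (simp add: bessel_kernel_def s_def power_int_add power2_eq_square mult_ac)
    finally have eq: "s powi n * c_const q v * (1 - q) *
        (q powi m * (qbessel_j q v (q powi n * q powi m) * (q powi m) powr (2 * v + 1))) =
        bessel_kernel q v (n + m) * s powi m" .
    show "of_real (s powi n * c_const q v * (1 - q)) *
        ((q powi m) *\<^sub>R (f (q powi m) * of_real (qbessel_j q v (q powi n * q powi m)) *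
           of_real ((q powi m) powr (2 * v + 1)))) =
        of_real (bessel_kernel q v (n + m)) * (of_real (s powi m) * f (q powi m))"
      using arg_cong[OF eq, of "\<lambda>r. of_real r * f (q powi m)"]
      by (simp only: scaleR_conv_of_real of_real_mult mult_ac)
  qed
  finally show ?thesis .
qed

text \<open>This is the substitution of \<open>q powi i * x\<close> for \<open>x\<close> in the
  Jackson integral: shifting \<open>n\<close> by \<open>i\<close> scales the weights by
  \<open>(s powi i)\<^sup>2 = (q powi i) powr (2 * v + 2)\<close>.\<close>

lemma sigma_const_has_sum:
  fixes q v a :: real and i :: int
  assumes q: "0 < q" "q < 1" and nz: "sigma_const q v a \<noteq> 0"
  shows "((\<lambda>n. exp (- ((q powi i * q powi n) powr a)) * ((q powr (v + 1)) powi n)\<^sup>2) has_sum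
            sigma_const q v a / ((1 - q) * (q powi i) powr (2 * v + 2))) UNIV"
proof -
  define s where "s = q powr (v + 1)"
  define g where "g n = exp (- ((q powi n) powr a)) * (s powi n)\<^sup>2" for n
  have s: "0 < s" using q by (simp add: s_def)
  have "(q powi n) *\<^sub>R (exp (- (\<bar>q powi n\<bar> powr a)) * (q powi n) powr (2 * v + 1)) = g n" for n
    using jackson_weight[OF q(1), of n v] q by (simp add: g_def s_def mult_ac)
  then have \<sigma>: "sigma_const q v a = (1 - q) * infsum g UNIV"
    by (simp add: sigma_const_def jackson_integral_def)
  \<comment> \<open>A divergent sum has \<open>infsum\<close> equal to 0, so a nonzero value
    certifies summability.\<close>
  with nz have "g summable_on UNIV"
    using infsum_not_exists by fastforce
  then have "(g has_sum (sigma_const q v a / (1 - q))) UNIV"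
    using q \<sigma> by simp
  then have "((\<lambda>n. g (n + i)) has_sum (sigma_const q v a / (1 - q))) UNIV"
    by (subst has_sum_reindex_bij_witness[of _ "\<lambda>n. n - i" "\<lambda>n. n + i"]) auto
  then have "((\<lambda>n. g (n + i) * (1 / (s powi i)\<^sup>2)) has_sum (sigma_const q v a / (1 - q) * (1 / (s powi i)\<^sup>2))) UNIV"
    by (rule has_sum_cmult_left)
  moreover have "g (n + i) * (1 / (s powi i)\<^sup>2) = exp (- ((q powi i * q powi n) powr a)) * (s powi n)\<^sup>2" for n
    using s q by (simp add: g_def power_int_add power_mult_distrib mult.commute[of "q powi i"])
  moreover have "(q powi i) powr (2 * v + 2) = (s powi i)\<^sup>2"
    using q by (simp add: powi_powr s_def power2_eq_square flip: power_int_mult_distrib powr_add)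
  ultimately show ?thesis
    by (simp add: s_def)
qed

theorem theorem2:
  fixes q v a b c d :: real and f :: "real \<Rightarrow> complex"
  assumes "0 < q" and "q < 1" and "v > -1" and "q \<in> Q_set v"
    and "a > 0" and "b > 0"
    and "c \<in> Rq_pos q" and "d \<in> Rq_pos q"
    and "0 < (B_const q v)\<^sup>2 * (sigma_const q v a * sigma_const q v b / (c * d) powr (2 * v + 2))"
    and "(B_const q v)\<^sup>2 * (sigma_const q v a * sigma_const q v b / (c * d) powr (2 * v + 2)) < 1"
    and "f \<in> Lq q 2 v"
  shows "ennreal (c powr a) * (Lq_norm q 2 v (\<lambda>x. of_real (x powr (a / 2)) * f x))\<^sup>2
       + ennreal (d powr b) * (Lq_norm q 2 v (\<lambda>x. of_real (x powr (b / 2)) * qbessel_fourier q v f x))\<^sup>2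
       \<ge> ennreal (- ln ((B_const q v)\<^sup>2 * (sigma_const q v a * sigma_const q v b / (c * d) powr (2 * v + 2))))
         * (Lq_norm q 2 v f)\<^sup>2"
proof -
  define s where "s = q powr (v + 1)"
  define u where "u = bessel_kernel q v"
  define \<phi> where "\<phi> n = of_real (s powi n) * f (q powi n)" for n
  define \<psi> where "\<psi> n = of_real (s powi n) * qbessel_fourier q v f (q powi n)" for n
  \<comment> \<open>The halves are there because the Hilbert--Schmidt norm squares
    \<open>exp (- \<alpha>)\<close> and \<open>exp (- \<beta>)\<close>; the squares are the
    exponentials in \<open>sigma_const\<close>, rescaled by \<open>d\<close> and
    \<open>c\<close>.\<close>
  define \<alpha> where "\<alpha> n = (d * q powi n) powr b / 2" for n
  define \<beta> where "\<beta> n = (c * q powi n) powr a / 2" for n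
  define K where "K = (B_const q v)\<^sup>2 * (sigma_const q v a * sigma_const q v b / (c * d) powr (2 * v + 2))"
  note q = assms(1,2) and v = assms(3)
  have K: "0 < K" "K < 1" using assms by (simp_all add: K_def)
  obtain i where c: "c = q powi i" using assms by (auto simp: Rq_pos_def)
  obtain j where d: "d = q powi j" using assms by (auto simp: Rq_pos_def)
  have pos: "0 < c" "0 < d" "0 < s" using q by (auto simp: c d s_def)
  \<comment> \<open>Positivity of the argument of the logarithm excludes the default value 0 of a
    divergent integral.\<close>
  have \<sigma>: "sigma_const q v a \<noteq> 0" "sigma_const q v b \<noteq> 0" using K(1) by (auto simp: K_def)
  note u = summable_bessel_kernel[OF q v, folded u_def]
    and ac = autocorrelation_bessel_kernel[OF q v, folded u_def]
    and bound = abs_bessel_kernel_le[OF q v, folded u_def s_def]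
  have \<psi>: "\<psi> = (\<lambda>n. \<Sum>\<^sub>\<infinity>m. of_real (u (n + m)) * \<phi> m)"
    unfolding \<psi>_def \<phi>_def u_def s_def by (rule ext) (rule qbessel_fourier_powi[OF q])
  have \<alpha>0: "0 \<le> \<alpha> n" and \<beta>0: "0 \<le> \<beta> n" for n
    by (simp_all add: \<alpha>_def \<beta>_def)
  have W: "((\<lambda>n. (exp (- \<beta> n) * s powi n)\<^sup>2) has_sum sigma_const q v a / ((1 - q) * c powr (2 * v + 2))) UNIV"
    using sigma_const_has_sum[OF q \<sigma>(1), of i]
    by (simp add: c s_def \<beta>_def power_mult_distrib flip: exp_double)
  have Z: "((\<lambda>n. (exp (- \<alpha> n) * s powi n)\<^sup>2) has_sum sigma_const q v b / ((1 - q) * d powr (2 * v + 2))) UNIV"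
    using sigma_const_has_sum[OF q \<sigma>(2), of j]
    by (simp add: d s_def \<alpha>_def power_mult_distrib flip: exp_double)
  \<comment> \<open>The kernel bound factorises through
    \<open>s powi (i + j) = s powi i * s powi j\<close>, so the double sum is at most the product of
    the totals in \<open>Z\<close> and \<open>W\<close>; the powers of \<open>1 - q\<close>
    cancel.\<close>
  have HS: "(\<Sum>i\<in>I. \<Sum>j\<in>J. (exp (- \<alpha> i) * u (i + j) * exp (- \<beta> j))\<^sup>2) \<le> (sqrt K)\<^sup>2"
    if fin: "finite I" "finite J" for I J
  proof -
    have "(exp (- \<alpha> i) * u (i + j) * exp (- \<beta> j))\<^sup>2 \<le>
        ((1 - q) * B_const q v)\<^sup>2 * ((exp (- \<alpha> i) * s powi i)\<^sup>2 * (exp (- \<beta> j) * s powi j)\<^sup>2)" for i j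
    proof -
      have "(u (i + j))\<^sup>2 \<le> ((1 - q) * B_const q v * s powi (i + j))\<^sup>2"
        using bound[of "i + j"] abs_ge_zero[of "u (i + j)"] by (subst power2_abs[symmetric]) (rule power_mono)
      then have "(exp (- \<alpha> i))\<^sup>2 * (u (i + j))\<^sup>2 * (exp (- \<beta> j))\<^sup>2 \<le>
          (exp (- \<alpha> i))\<^sup>2 * ((1 - q) * B_const q v * s powi (i + j))\<^sup>2 * (exp (- \<beta> j))\<^sup>2"
        by (intro mult_left_mono mult_right_mono) auto
      then show ?thesis
        using pos by (simp add: power_int_add power_mult_distrib mult_ac)
    qed
    then have "(\<Sum>i\<in>I. \<Sum>j\<in>J. (exp (- \<alpha> i) * u (i + j) * exp (- \<beta> j))\<^sup>2) \<le>
        (\<Sum>i\<in>I. \<Sum>j\<in>J. ((1 - q) * B_const q v)\<^sup>2 * ((exp (- \<alpha> i) * s powi i)\<^sup>2 * (exp (- \<beta> j) * s powi j)\<^sup>2))"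
      by (intro sum_mono)
    also have "\<dots> = ((1 - q) * B_const q v)\<^sup>2 *
        ((\<Sum>i\<in>I. (exp (- \<alpha> i) * s powi i)\<^sup>2) * (\<Sum>j\<in>J. (exp (- \<beta> j) * s powi j)\<^sup>2))"
      unfolding sum_product by (simp only: sum_distrib_left)
    also have "\<dots> \<le> ((1 - q) * B_const q v)\<^sup>2 *
        (sigma_const q v b / ((1 - q) * d powr (2 * v + 2)) * (sigma_const q v a / ((1 - q) * c powr (2 * v + 2))))"
      by (intro mult_left_mono mult_mono finite_sum_le_has_sum[OF W] finite_sum_le_has_sum[OF Z]
           fin sum_nonneg has_sum_nonneg[OF Z]) auto
    also have "\<dots> = K"
    proof -
      have "(r * B)\<^sup>2 * (y / (r * D) * (x / (r * C))) = B\<^sup>2 * (x * y / (C * D))" if "r \<noteq> 0" for r B C D x y :: real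
        using that by (simp add: power2_eq_square mult_ac)
      then show ?thesis using pos q by (simp add: K_def powr_mult)
    qed
    finally show ?thesis using K by simp
  qed
  have norm_f: "(Lq_norm q 2 v f)\<^sup>2 = ennreal (1 - q) * (\<Sum>\<^sub>\<infinity>n. ennreal ((cmod (\<phi> n))\<^sup>2))"
    by (simp add: Lq_norm_2_power2[OF q] \<phi>_def s_def)
  \<comment> \<open>The scale \<open>C\<close> enters the weight, and the factor 2 undoes the
    halving in \<open>\<alpha>\<close> and \<open>\<beta>\<close>.\<close>
  have weighted: "ennreal (C powr t) * (Lq_norm q 2 v (\<lambda>x. of_real (x powr (t / 2)) * g x))\<^sup>2 =
      ennreal (2 * (1 - q)) * (\<Sum>\<^sub>\<infinity>n. ennreal ((C * q powi n) powr t / 2 * (cmod (of_real (s powi n) * g (q powi n)))\<^sup>2))"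
    if "0 < C" for C t :: real and g
  proof -
    define S where "S = (\<Sum>\<^sub>\<infinity>n. ennreal ((cmod (of_real (s powi n) *
      (of_real ((q powi n) powr (t / 2)) * g (q powi n))))\<^sup>2))"
    have "ennreal ((C * q powi n) powr t / 2 * (cmod (of_real (s powi n) * g (q powi n)))\<^sup>2) =
        ennreal (C powr t / 2) * ennreal ((cmod (of_real (s powi n) * (of_real ((q powi n) powr (t / 2)) * g (q powi n))))\<^sup>2)" for n
    proof -
      have "((q powi n) powr (t / 2))\<^sup>2 = (q powi n) powr t"
        using q by (simp add: power2_eq_square flip: powr_add)
      then have "(C * q powi n) powr t / 2 * (cmod (of_real (s powi n) * g (q powi n)))\<^sup>2 =
          C powr t / 2 * (cmod (of_real (s powi n) * (of_real ((q powi n) powr (t / 2)) * g (q powi n))))\<^sup>2"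
        unfolding norm_mult norm_of_real power_mult_distrib power2_abs
        using that q by (simp add: powr_mult mult_ac)
      then show ?thesis by (simp flip: ennreal_mult)
    qed
    then have "(\<Sum>\<^sub>\<infinity>n. ennreal ((C * q powi n) powr t / 2 * (cmod (of_real (s powi n) * g (q powi n)))\<^sup>2)) =
        ennreal (C powr t / 2) * S"
      unfolding S_def by (simp only: infsum_cmult_right_ennreal)
    moreover have "(Lq_norm q 2 v (\<lambda>x. of_real (x powr (t / 2)) * g x))\<^sup>2 = ennreal (1 - q) * S"
      unfolding Lq_norm_2_power2[OF q] S_def s_def ..
    moreover have "ennreal (2 * (1 - q)) * ennreal (C powr t / 2) = ennreal (C powr t) * ennreal (1 - q)"
      using q by (subst (1 2) ennreal_mult[symmetric]) (simp_all add: mult.commute)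
    ultimately show ?thesis
      by (simp only: mult.assoc[symmetric])
  qed
  have A: "ennreal (c powr a) * (Lq_norm q 2 v (\<lambda>x. of_real (x powr (a / 2)) * f x))\<^sup>2 =
      ennreal (2 * (1 - q)) * (\<Sum>\<^sub>\<infinity>n. ennreal (\<beta> n * (cmod (\<phi> n))\<^sup>2))"
    unfolding weighted[OF pos(1)] \<beta>_def \<phi>_def ..
  have B: "ennreal (d powr b) * (Lq_norm q 2 v (\<lambda>x. of_real (x powr (b / 2)) * qbessel_fourier q v f x))\<^sup>2 =
      ennreal (2 * (1 - q)) * (\<Sum>\<^sub>\<infinity>n. ennreal (\<alpha> n * (cmod (\<psi> n))\<^sup>2))"
    unfolding weighted[OF pos(2)] \<alpha>_def \<psi>_def ..
  have "Lq_norm q 2 v f < \<infinity>" using assms(11) by (simp add: Lq_def)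
  then have "(Lq_norm q 2 v f)\<^sup>2 \<noteq> \<infinity>" by (simp add: power_eq_top_ennreal)
  then have fin\<phi>: "(\<Sum>\<^sub>\<infinity>n. ennreal ((cmod (\<phi> n))\<^sup>2)) \<noteq> \<infinity>"
    using q by (auto simp: norm_f ennreal_mult_eq_top_iff)
  note \<phi>sum = infsum_ennreal_finite[OF _ fin\<phi>, simplified]
  show ?thesis
  \<comment> \<open>An infinite weighted norm makes the larger side infinite; otherwise all sums are
    real.\<close>
  proof (cases "(\<Sum>\<^sub>\<infinity>n. ennreal (\<beta> n * (cmod (\<phi> n))\<^sup>2)) = \<infinity> \<or> (\<Sum>\<^sub>\<infinity>n. ennreal (\<alpha> n * (cmod (\<psi> n))\<^sup>2)) = \<infinity>")
    case True
    then show ?thesis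
      unfolding A B using q by (auto simp: ennreal_mult_eq_top_iff)
  next
    case False
    then have fin: "(\<Sum>\<^sub>\<infinity>n. ennreal (\<beta> n * (cmod (\<phi> n))\<^sup>2)) \<noteq> \<infinity>" "(\<Sum>\<^sub>\<infinity>n. ennreal (\<alpha> n * (cmod (\<psi> n))\<^sup>2)) \<noteq> \<infinity>"
      by auto
    have nn: "0 \<le> \<beta> n * (cmod (\<phi> n))\<^sup>2" "0 \<le> \<alpha> n * (cmod (\<psi> n))\<^sup>2" for n
      using \<alpha>0 \<beta>0 by simp_all
    note \<beta>sum = infsum_ennreal_finite[OF nn(1) fin(1)] and \<alpha>sum = infsum_ennreal_finite[OF nn(2) fin(2)]
    have "- ln (sqrt K) * (\<Sum>\<^sub>\<infinity>n. (cmod (\<phi> n))\<^sup>2)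
        \<le> (\<Sum>\<^sub>\<infinity>n. \<beta> n * (cmod (\<phi> n))\<^sup>2) + (\<Sum>\<^sub>\<infinity>n. \<alpha> n * (cmod (\<psi> n))\<^sup>2)"
      using complex_uncertainty_of_autocorrelation[OF u ac \<alpha>0 \<beta>0 _ HS \<phi>sum(1) \<beta>sum(1)] \<alpha>sum(1) K(1)
      unfolding \<psi> by simp
    \<comment> \<open>The root in \<open>sqrt K\<close> halves the logarithm, which the factor 2
      from the halved weights makes up for.\<close>
    moreover have half: "2 * (1 - q) * (- ln (sqrt K) * N) = - ln K * ((1 - q) * N)" for N
      using K by (simp add: ln_sqrt)
    ultimately have "2 * (1 - q) * (- ln (sqrt K) * (\<Sum>\<^sub>\<infinity>n. (cmod (\<phi> n))\<^sup>2))
        \<le> 2 * (1 - q) * ((\<Sum>\<^sub>\<infinity>n. \<beta> n * (cmod (\<phi> n))\<^sup>2) + (\<Sum>\<^sub>\<infinity>n. \<alpha> n * (cmod (\<psi> n))\<^sup>2))"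
      using q by (intro mult_left_mono) auto
    then have "- ln K * ((1 - q) * (\<Sum>\<^sub>\<infinity>n. (cmod (\<phi> n))\<^sup>2))
        \<le> 2 * (1 - q) * (\<Sum>\<^sub>\<infinity>n. \<beta> n * (cmod (\<phi> n))\<^sup>2) + 2 * (1 - q) * (\<Sum>\<^sub>\<infinity>n. \<alpha> n * (cmod (\<psi> n))\<^sup>2)"
      unfolding half distrib_left .
    then have "ennreal (- ln K * ((1 - q) * (\<Sum>\<^sub>\<infinity>n. (cmod (\<phi> n))\<^sup>2)))
        \<le> ennreal (2 * (1 - q) * (\<Sum>\<^sub>\<infinity>n. \<beta> n * (cmod (\<phi> n))\<^sup>2) + 2 * (1 - q) * (\<Sum>\<^sub>\<infinity>n. \<alpha> n * (cmod (\<psi> n))\<^sup>2))"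
      by (rule ennreal_leI)
    moreover have "ennreal (- ln K * ((1 - q) * N)) = ennreal (- ln K) * (ennreal (1 - q) * ennreal N)"
      if "0 \<le> N" for N
      using ennreal_mult[of "- ln K" "(1 - q) * N"] ennreal_mult[of "1 - q" N] q K that by simp
    ultimately show ?thesis
      unfolding A B norm_f K_def[symmetric] \<phi>sum(2) \<beta>sum(2) \<alpha>sum(2)
      using q nn by (simp add: ennreal_mult infsum_nonneg ennreal_plus)
  qed
qed

end
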